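(* Let $d \ge 3$, let $G = \mathbb{Z}^d$ (the nearest-neighbour integer lattice), and let $\mathcal{P}$ be the property of being a transient graph. Then for any $\epsilon > 0$ there is a recurrent subgraph $H_{\epsilon}$ of $G$ such that $p_{c,2}(G, H_{\epsilon}, \mathcal{P}) \le \epsilon$.
   Context: Graphs are locally finite, simple and non-oriented. A connected graph is called transient (resp. recurrent) if the simple random walk on it is transient (resp. recurrent); in particular a recurrent subgraph is connected. Bernoulli bond percolation: for $p \in [0,1]$, $\mathbb{P}_p$ is the product measure on $\{0,1\}^{E(G)}$ under which each edge $e$ is open ($\omega_e = 1$) with probability $p$ independently, and closed ($\omega_e=0$) otherwise. $C_x$ is the open cluster containing $x \in V(G)$ (with $x \in V(C_x)$ always). Enlargement: for a subgraph $H$ of $G$, $\mathcal{U}_p(H)$ is the random subgraph of $G$ with $V(\mathcal{U}_p(H)) = \bigcup_{x \in V(H)} V(C_x)$ and $E(\mathcal{U}_p(H)) = E(H) \cup \bigcup_{x \in V(H)} E(C_x)$, where the configuration is chosen according to $\mathbb{P}_p$. $p_{c,2}(G,H,\mathcal{P}) := \inf\{p \in [0,1] : \mathbb{P}_p(\mathcal{U}_p(H) \in \mathcal{P}) = 1\}$, where $X \in \mathcal{P}$ means that the subgraph $X$ of $G$ satisfies the property $\mathcal{P}$. *)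

theory Defs
  imports "HOL-Probability.Probability"
begin

section \<open>Graphs\<close>

record 'a ugraph =
  verts :: "'a set"
  edges :: "'a set set"

definition simple_graph :: "'a ugraph \<Rightarrow> bool" where
  "simple_graph G \<longleftrightarrow> (\<forall>e\<in>edges G. e \<subseteq> verts G \<and> card e = 2)"

definition neighbours :: "'a ugraph \<Rightarrow> 'a \<Rightarrow> 'a set" where
  "neighbours G v = {w. {v, w} \<in> edges G}"

definition locally_finite :: "'a ugraph \<Rightarrow> bool" where
  "locally_finite G \<longleftrightarrow> (\<forall>v\<in>verts G. finite (neighbours G v))"

definition subgraph :: "'a ugraph \<Rightarrow> 'a ugraph \<Rightarrow> bool" where
  "subgraph H G \<longleftrightarrow> simple_graph H \<and> verts H \<subseteq> verts G \<and> edges H \<subseteq> edges G"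

definition reachable :: "'a ugraph \<Rightarrow> 'a \<Rightarrow> 'a \<Rightarrow> bool" where
  "reachable G = (\<lambda>u v. {u, v} \<in> edges G)\<^sup>*\<^sup>*"

definition connected_graph :: "'a ugraph \<Rightarrow> bool" where
  "connected_graph G \<longleftrightarrow> verts G \<noteq> {} \<and> (\<forall>u\<in>verts G. \<forall>v\<in>verts G. reachable G u v)"

text \<open>The nearest-neighbour lattice of dimension \<open>CARD('d)\<close>: edges join points at
  \<open>\<ell>\<^sup>1\<close>-distance one.\<close>

definition int_lattice :: "(int ^ 'd) ugraph" where
  "int_lattice = \<lparr>verts = UNIV, edges = {{x, y} | x y. (\<Sum>i\<in>UNIV. \<bar>x $ i - y $ i\<bar>) = 1}\<rparr>"


section \<open>Simple random walk, recurrence and transience\<close>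

text \<open>At a vertex without neighbours the walk stays put, so the graph with a single vertex is
  recurrent. The definition is only meaningful for locally finite graphs.\<close>

definition srw_step :: "'a ugraph \<Rightarrow> 'a \<Rightarrow> 'a pmf" where
  "srw_step G v =
    (if neighbours G v = {} then return_pmf v else pmf_of_set (neighbours G v))"

text \<open>The walk is realised on a space of independent instructions: \<open>\<sigma> (n, v)\<close>, distributed as one
  step from \<open>v\<close>, is where the walk goes next if it is at \<open>v\<close> at time \<open>n\<close>. Each instruction is used
  at most once, so this is the Markov chain with kernel \<open>srw_step G\<close>; see \<open>srw_path_prob\<close> below.\<close>

definition srw_space :: "'a ugraph \<Rightarrow> (nat \<times> 'a \<Rightarrow> 'a) measure" where
  "srw_space G = Pi\<^sub>M UNIV (\<lambda>(n, v). measure_pmf (srw_step G v))"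

primrec srw :: "'a \<Rightarrow> (nat \<times> 'a \<Rightarrow> 'a) \<Rightarrow> nat \<Rightarrow> 'a" where
  "srw x \<sigma> 0 = x"
| "srw x \<sigma> (Suc n) = \<sigma> (n, srw x \<sigma> n)"

definition return_prob :: "'a ugraph \<Rightarrow> 'a \<Rightarrow> real" where
  "return_prob G x = measure (srw_space G) {\<sigma> \<in> space (srw_space G). \<exists>n\<ge>1. srw x \<sigma> n = x}"

definition recurrent :: "'a ugraph \<Rightarrow> bool" where
  "recurrent G \<longleftrightarrow> connected_graph G \<and> (\<forall>x\<in>verts G. return_prob G x = 1)"

definition transient :: "'a ugraph \<Rightarrow> bool" where
  "transient G \<longleftrightarrow> connected_graph G \<and> (\<forall>x\<in>verts G. return_prob G x < 1)"


section \<open>Bernoulli bond percolation and enlargements\<close>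

definition percolation :: "'a ugraph \<Rightarrow> real \<Rightarrow> ('a set \<Rightarrow> bool) measure" where
  "percolation G p = Pi\<^sub>M (edges G) (\<lambda>_. measure_pmf (bernoulli_pmf p))"

definition open_subgraph :: "'a ugraph \<Rightarrow> ('a set \<Rightarrow> bool) \<Rightarrow> 'a ugraph" where
  "open_subgraph G \<omega> = \<lparr>verts = verts G, edges = {e \<in> edges G. \<omega> e}\<rparr>"

definition open_cluster :: "'a ugraph \<Rightarrow> ('a set \<Rightarrow> bool) \<Rightarrow> 'a \<Rightarrow> 'a ugraph" where
  "open_cluster G \<omega> x = (let C = {y. reachable (open_subgraph G \<omega>) x y} in
     \<lparr>verts = C, edges = {e \<in> edges (open_subgraph G \<omega>). e \<subseteq> C}\<rparr>)"

definition enlargement :: "'a ugraph \<Rightarrow> 'a ugraph \<Rightarrow> ('a set \<Rightarrow> bool) \<Rightarrow> 'a ugraph" where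
  "enlargement G H \<omega> =
    \<lparr>verts = (\<Union>x\<in>verts H. verts (open_cluster G \<omega> x)),
     edges = edges H \<union> (\<Union>x\<in>verts H. edges (open_cluster G \<omega> x))\<rparr>"

text \<open>The infimum is taken in the extended reals, so that it is \<open>\<infinity>\<close> (and not an unspecified real)
  if there is no admissible \<open>p\<close>.\<close>

definition pc2 :: "'a ugraph \<Rightarrow> 'a ugraph \<Rightarrow> ('a ugraph \<Rightarrow> bool) \<Rightarrow> ereal" where
  "pc2 G H P =
    Inf (ereal ` {p \<in> {0..1}. AE \<omega> in percolation G p. P (enlargement G H \<omega>)})"


section \<open>Basic facts\<close>

lemma simple_graph_int_lattice: "simple_graph int_lattice"
proof -
  have "x \<noteq> y" if "(\<Sum>i\<in>UNIV. \<bar>x $ i - y $ i\<bar>) = 1" for x y :: "int ^ 'd"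
    using that by auto
  then show ?thesis
    by (auto simp: simple_graph_def int_lattice_def card_insert_if)
qed

lemma neighbours_int_lattice:
  "neighbours int_lattice x = {y. (\<Sum>i\<in>UNIV. \<bar>x $ i - y $ i\<bar>) = 1}"
  by (auto simp: neighbours_def int_lattice_def doubleton_eq_iff abs_minus_commute)

lemma locally_finite_int_lattice: "locally_finite (int_lattice :: (int ^ 'd) ugraph)"
proof -
  have "finite (neighbours int_lattice x)" for x :: "int ^ 'd"
  proof (rule finite_subset)
    show "finite (vec_lambda ` (Pi\<^sub>E (UNIV :: 'd set) (\<lambda>i. {x $ i - 1 .. x $ i + 1})))"
      by (intro finite_imageI finite_PiE) auto
    show "neighbours int_lattice x \<subseteq> vec_lambda ` (Pi\<^sub>E UNIV (\<lambda>i. {x $ i - 1 .. x $ i + 1}))"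
    proof
      fix y assume "y \<in> neighbours int_lattice x"
      then have 1: "(\<Sum>i\<in>UNIV. \<bar>x $ i - y $ i\<bar>) = 1"
        by (simp add: neighbours_int_lattice)
      have "\<bar>x $ i - y $ i\<bar> \<le> 1" for i
        unfolding 1[symmetric] by (rule member_le_sum) auto
      then have "y $ i \<in> {x $ i - 1 .. x $ i + 1}" for i
        by (smt (verit, best) atLeastAtMost_iff)
      then have "vec_nth y \<in> Pi\<^sub>E UNIV (\<lambda>i. {x $ i - 1 .. x $ i + 1})"
        by (simp add: PiE_UNIV_domain)
      then show "y \<in> vec_lambda ` (Pi\<^sub>E UNIV (\<lambda>i. {x $ i - 1 .. x $ i + 1}))"
        by (metis image_eqI vec_nth_inverse)
    qed
  qed
  then show ?thesis by (simp add: locally_finite_def)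
qed

lemma locally_finite_subgraph:
  assumes "subgraph H G" "locally_finite G"
  shows "locally_finite H"
  unfolding locally_finite_def
proof
  fix v assume "v \<in> verts H"
  then have "finite (neighbours G v)"
    using assms by (auto simp: subgraph_def locally_finite_def)
  then show "finite (neighbours H v)"
    by (rule rev_finite_subset) (use assms in \<open>auto simp: subgraph_def neighbours_def\<close>)
qed

lemma subgraph_enlargement:
  assumes "simple_graph G" "subgraph H G"
  shows "subgraph (enlargement G H \<omega>) G"
proof -
  have reach: "y \<in> verts G" if "reachable (open_subgraph G \<omega>) x y" "x \<in> verts G" for x y
    using that unfolding reachable_def
  proof (induction rule: rtranclp_induct)
    case (step y z)
    then have "{y, z} \<in> edges G" by (simp add: open_subgraph_def)
    then show ?case
      using \<open>simple_graph G\<close> unfolding simple_graph_def by blast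
  qed
  have refl: "reachable (open_subgraph G \<omega>) x x" for x
    by (simp add: reachable_def)
  have HG: "x \<in> verts G" if "x \<in> verts H" for x
    using that assms by (auto simp: subgraph_def)
  have eH: "e \<subseteq> verts H" "card e = 2" "e \<in> edges G" if "e \<in> edges H" for e
    using that assms by (auto simp: subgraph_def simple_graph_def)
  have eG: "card e = 2" if "e \<in> edges G" for e
    using that assms by (auto simp: simple_graph_def)
  show ?thesis
    unfolding subgraph_def simple_graph_def
  proof (intro conjI ballI)
    fix e assume e: "e \<in> edges (enlargement G H \<omega>)"
    have V: "verts (enlargement G H \<omega>) = (\<Union>x\<in>verts H. {y. reachable (open_subgraph G \<omega>) x y})"
      by (simp add: enlargement_def open_cluster_def Let_def)
    have "e \<in> edges H \<or> (e \<in> edges G \<and>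
        (\<exists>x\<in>verts H. e \<subseteq> {y. reachable (open_subgraph G \<omega>) x y}))"
      using e by (auto simp: enlargement_def open_cluster_def open_subgraph_def Let_def)
    then show "e \<subseteq> verts (enlargement G H \<omega>)" "card e = 2"
      using eH eG refl unfolding V by blast+
  next
    show "verts (enlargement G H \<omega>) \<subseteq> verts G"
      using reach HG by (auto simp: enlargement_def open_cluster_def Let_def)
    show "edges (enlargement G H \<omega>) \<subseteq> edges G"
      using eH by (auto simp: enlargement_def open_cluster_def open_subgraph_def Let_def)
  qed
qed

lemma measurable_srw:
  fixes x :: "'a :: countable"
  shows "(\<lambda>\<sigma>. srw x \<sigma> n) \<in> measurable (srw_space G) (count_space UNIV)"
proof (induction n)
  case (Suc n)
  have "(\<lambda>\<sigma>. \<sigma> (n, v)) \<in> measurable (srw_space G) (count_space UNIV)" for v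
    using measurable_component_singleton[of "(n, v)" UNIV "\<lambda>(n, v). measure_pmf (srw_step G v)"]
    by (simp add: srw_space_def)
  then show ?case
    unfolding srw.simps by (rule measurable_compose_countable[OF _ Suc])
qed simp

lemma return_event_measurable:
  fixes x :: "'a :: countable"
  shows "{\<sigma> \<in> space (srw_space G). \<exists>n\<ge>1. srw x \<sigma> n = x} \<in> sets (srw_space G)"
proof -
  have "{\<sigma> \<in> space (srw_space G). srw x \<sigma> n = x} \<in> sets (srw_space G)" for n
    using measurable_sets[OF measurable_srw, of "{x}"]
    by (simp add: vimage_def Int_def conj_commute)
  moreover have "{\<sigma> \<in> space (srw_space G). \<exists>n\<ge>1. srw x \<sigma> n = x} =
      (\<Union>n\<in>{1..}. {\<sigma> \<in> space (srw_space G). srw x \<sigma> n = x})"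
    by auto
  ultimately show ?thesis by auto
qed

lemma srw_path_prob:
  "measure (srw_space G) {\<sigma> \<in> space (srw_space G). \<forall>k\<le>n. srw (xs 0) \<sigma> k = xs k} =
    (\<Prod>k<n. pmf (srw_step G (xs k)) (xs (Suc k)))"
proof -
  define M where "M = (\<lambda>(k :: nat, v). measure_pmf (srw_step G v))"
  interpret product_prob_space M UNIV
    by (rule product_prob_spaceI) (auto simp: M_def measure_pmf.prob_space_axioms split: prod.splits)
  define J where "J = (\<lambda>k. (k, xs k)) ` {..<n}"
  define X where "X = (\<lambda>(k, v :: 'a). {xs (Suc k)})"
  have path: "(\<forall>k\<le>n. srw (xs 0) \<sigma> k = xs k) \<longleftrightarrow> (\<forall>k<n. \<sigma> (k, xs k) = xs (Suc k))" for \<sigma>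
  proof (induction n)
    case (Suc n)
    have "(\<forall>k\<le>Suc n. srw (xs 0) \<sigma> k = xs k) \<longleftrightarrow>
        (\<forall>k\<le>n. srw (xs 0) \<sigma> k = xs k) \<and> \<sigma> (n, xs n) = xs (Suc n)"
      (is "?A \<longleftrightarrow> ?B \<and> ?C")
    proof -
      have "?A \<longleftrightarrow> ?B \<and> srw (xs 0) \<sigma> (Suc n) = xs (Suc n)"
        by (auto simp: le_Suc_eq simp del: srw.simps)
      then show ?thesis by auto
    qed
    then show ?case
      unfolding Suc.IH by (auto simp: less_Suc_eq)
  qed simp
  have "{\<sigma> \<in> space (srw_space G). \<forall>k\<le>n. srw (xs 0) \<sigma> k = xs k} =
      prod_emb UNIV M J (Pi\<^sub>E J X)"
    unfolding path
    by (auto simp: srw_space_def prod_emb_def space_PiM J_def X_def M_def restrict_def PiE_iff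
        extensional_def split: prod.splits)
  moreover have "measure (Pi\<^sub>M UNIV M) (prod_emb UNIV M J (Pi\<^sub>E J X)) = (\<Prod>j\<in>J. measure (M j) (X j))"
    by (rule measure_PiM_emb) (auto simp: J_def X_def M_def)
  moreover have "(\<Prod>j\<in>J. measure (M j) (X j)) = (\<Prod>k<n. pmf (srw_step G (xs k)) (xs (Suc k)))"
    unfolding J_def
    by (subst prod.reindex) (auto simp: inj_on_def M_def X_def measure_pmf_single)
  ultimately show ?thesis
    by (simp add: srw_space_def M_def)
qed

end

theory Submission
  imports Defs
begin

text \<open>
  Recurrence and transience are read off the Dirichlet energy of finitely supported functions \<open>f\<close>. The walk
  returns to \<open>x\<close> almost surely if \<open>f x\<close> can be kept close to 1 at arbitrarily small energy
  (\<open>return_prob_eq_1_of_energy_tendsto_0\<close>), and with probability less than 1 if \<open>f x\<close> is bounded by a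
  multiple of the root of the energy (\<open>return_prob_less_1_of_energy_bound\<close>). Both facts
  rest on the probability of hitting \<open>x\<close> within \<open>n\<close> steps, as a function of the starting point: it has the value 1
  at \<open>x\<close>, and its energy is controlled by the probability of not returning to \<open>x\<close>.

  One recurrent graph, called \<open>chain\<close> below, serves for every \<open>\<epsilon>\<close>. It lies in a three-dimensional octant of the
  lattice and consists of rooms \<open>[0, 4\<^sup>k)\<^sup>2 \<times> [4\<^sup>k, 4\<^sup>k\<^sup>+\<^sup>1)\<close>. Each room contains all of its
  lattice edges, but consecutive rooms are joined by a single edge. The function that decreases from 1 to 0 in steps of
  \<open>1/n\<close> over \<open>n\<close> rooms has energy of order \<open>1/n\<close>, so the chain is recurrent (\<open>recurrent_chain\<close>).

  Let \<open>p > 0\<close>. Percolation reopens a part of each wall between consecutive rooms: if the wall behind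
  room \<open>k\<close> is divided into \<open>8\<^sup>k\<close> rows of \<open>2\<^sup>k\<close> edges, then almost surely, for all but finitely many
  \<open>k\<close>, every row contains an open edge (\<open>AE_eventually_all_blocks_open\<close>). These doors are spread out so evenly
  that the means of \<open>f\<close> over rooms \<open>k\<close> and \<open>k + 1\<close> differ by at most a constant times
  \<open>2\<^sup>-\<^sup>k\<^sup>/\<^sup>2\<close> times the root of the energy (\<open>room_mean_step\<close>): mass is carried from one room to the next along
  many disjoint lines, and \<open>N\<close> lines of length \<open>n\<close> have resistance \<open>n/N\<close>. Here three dimensions matter, since the number
  of parallel lines grows faster than their length. As \<open>f\<close> vanishes in far rooms, summing the geometric series
  bounds its mean over a fixed room, and hence its value at a vertex, by the energy. So the enlargement
  is transient for each \<open>p > 0\<close>.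
\<close>

section \<open>Return probabilities as limits of hitting probabilities\<close>

text \<open>The law of the first \<open>n\<close> steps as a \<open>pmf\<close> on lists: unlike the instruction space, it can be
  decomposed at the first step, which is what the recursion for hitting probabilities needs.\<close>

primrec walk_pmf :: "'a ugraph \<Rightarrow> nat \<Rightarrow> 'a \<Rightarrow> 'a list pmf" where
  "walk_pmf G 0 y = return_pmf [y]"
| "walk_pmf G (Suc n) y = bind_pmf (srw_step G y) (\<lambda>w. map_pmf (Cons y) (walk_pmf G n w))"

lemma pmf_walk_pmf:
  "pmf (walk_pmf G n y) l =
    (if length l = Suc n \<and> l ! 0 = y then \<Prod>k<n. pmf (srw_step G (l ! k)) (l ! Suc k) else 0)"
proof (induction n arbitrary: y l)
  case 0
  have "length l = Suc 0 \<and> l ! 0 = y \<longleftrightarrow> l = [y]"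
    by (auto simp: length_Suc_conv)
  then show ?case
    by (simp add: pmf_return)
next
  case (Suc n)
  show ?case
  proof (cases "\<exists>l'. l = y # l' \<and> length l' = Suc n")
    case True
    then obtain l' where l': "l = y # l'" "length l' = Suc n" by blast
    have "pmf (walk_pmf G (Suc n) y) l = (\<integral>w. pmf (walk_pmf G n w) l' \<partial>measure_pmf (srw_step G y))"
      by (simp add: pmf_bind l' pmf_map_inj')
    also have "\<dots> = (\<Sum>w\<in>{l' ! 0}. pmf (walk_pmf G n w) l' * pmf (srw_step G y) w)"
      by (rule integral_measure_pmf_real) (auto simp: Suc.IH split: if_splits)
    finally show ?thesis
      by (simp add: Suc.IH l' prod.lessThan_Suc_shift mult.commute del: prod.lessThan_Suc)
  next
    case False
    have "pmf (map_pmf (Cons y) (walk_pmf G n w)) l = 0" for w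
    proof -
      have "l' \<in> set_pmf (walk_pmf G n w) \<Longrightarrow> length l' = Suc n" for l'
        by (simp add: set_pmf_iff Suc.IH split: if_splits)
      then have "l \<notin> Cons y ` set_pmf (walk_pmf G n w)"
        using False by blast
      then show ?thesis
        by (simp add: pmf_eq_0_set_pmf)
    qed
    moreover have "\<not> (length l = Suc (Suc n) \<and> l ! 0 = y)"
      using False by (cases l) auto
    ultimately show ?thesis
      by (simp only: walk_pmf.simps pmf_bind if_False) simp
  qed
qed

text \<open>Both sides are measures on the countable set of lists, so they agree once they agree on each
  single path, and there \<open>srw_path_prob\<close> and \<open>pmf_walk_pmf\<close> give the same product.\<close>

lemma srw_distribution:
  fixes y :: "'a :: countable"
  shows "measure (srw_space G) {\<sigma> \<in> space (srw_space G). Q (map (srw y \<sigma>) [0..<Suc n])} =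
    measure_pmf.prob (walk_pmf G n y) {l. Q l}"
proof -
  define X where "X = (\<lambda>\<sigma>. map (srw y \<sigma>) [0..<Suc n])"
  interpret prob_space "srw_space G"
    unfolding srw_space_def
    by (rule prob_space_PiM) (auto simp: measure_pmf.prob_space_axioms split: prod.splits)
  have X_eq: "X \<sigma> = l \<longleftrightarrow> length l = Suc n \<and> (\<forall>k\<le>n. srw y \<sigma> k = l ! k)" for \<sigma> l
    by (auto simp: X_def list_eq_iff_nth_eq less_Suc_eq_le simp del: upt_Suc)
  have level: "{\<sigma> \<in> space (srw_space G). X \<sigma> = l} \<in> sets (srw_space G)" for l
  proof -
    have "{\<sigma> \<in> space (srw_space G). srw y \<sigma> k = v} \<in> sets (srw_space G)" for k v
      using measurable_sets[OF measurable_srw, of "{v}"]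
      by (simp add: vimage_def Int_def conj_commute)
    then show ?thesis
      unfolding X_eq by measurable
  qed
  have X_meas: "X \<in> measurable (srw_space G) (count_space UNIV)"
  proof (rule measurable_count_space_eq_countable[THEN iffD2], simp, intro conjI ballI)
    fix l :: "'a list"
    have "X -` {l} \<inter> space (srw_space G) = {\<sigma> \<in> space (srw_space G). X \<sigma> = l}" by auto
    then show "X -` {l} \<inter> space (srw_space G) \<in> sets (srw_space G)"
      using level by simp
  qed simp
  have "distr (srw_space G) (count_space UNIV) X = measure_pmf (walk_pmf G n y)"
  proof (rule measure_eqI_countable[where A = UNIV])
    fix l :: "'a list"
    have "emeasure (distr (srw_space G) (count_space UNIV) X) {l} =
        prob {\<sigma> \<in> space (srw_space G). X \<sigma> = l}"
      using X_meas by (simp add: emeasure_distr emeasure_eq_measure vimage_def Int_def conj_commute)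
    also have "prob {\<sigma> \<in> space (srw_space G). X \<sigma> = l} = pmf (walk_pmf G n y) l"
    proof (cases "length l = Suc n \<and> l ! 0 = y")
      case True
      then have "{\<sigma> \<in> space (srw_space G). X \<sigma> = l} =
          {\<sigma> \<in> space (srw_space G). \<forall>k\<le>n. srw (l ! 0) \<sigma> k = l ! k}"
        unfolding X_eq by auto
      then show ?thesis
        using True srw_path_prob[where xs = "\<lambda>k. l ! k"] by (simp add: pmf_walk_pmf)
    next
      case False
      have "srw y \<sigma> 0 = y" for \<sigma> by simp
      then have none: "{\<sigma> \<in> space (srw_space G). X \<sigma> = l} = {}"
        using False unfolding X_eq by (metis (mono_tags, lifting) Collect_empty_eq zero_le)
      show ?thesis
        unfolding none using False by (auto simp: pmf_walk_pmf)
    qed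
    finally show "emeasure (distr (srw_space G) (count_space UNIV) X) {l} =
        emeasure (measure_pmf (walk_pmf G n y)) {l}"
      by (simp add: emeasure_pmf_single)
  qed simp_all
  then have "measure_pmf.prob (walk_pmf G n y) {l. Q l} =
      measure (distr (srw_space G) (count_space UNIV) X) {l. Q l}" by simp
  also have "\<dots> = measure (srw_space G) (X -` {l. Q l} \<inter> space (srw_space G))"
    by (rule measure_distr[OF X_meas]) simp
  also have "X -` {l. Q l} \<inter> space (srw_space G) =
      {\<sigma> \<in> space (srw_space G). Q (map (srw y \<sigma>) [0..<Suc n])}"
    by (auto simp: X_def)
  finally show ?thesis by simp
qed

text \<open>The probability that the walk from \<open>y\<close> visits \<open>x\<close> at one of the times \<open>0, \<dots>, n\<close>; see
  \<open>prob_walk_hits\<close>.\<close>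

primrec hit_within :: "'a ugraph \<Rightarrow> 'a \<Rightarrow> nat \<Rightarrow> 'a \<Rightarrow> real" where
  "hit_within G x 0 y = (if y = x then 1 else 0)"
| "hit_within G x (Suc n) y =
    (if y = x then 1 else measure_pmf.expectation (srw_step G y) (hit_within G x n))"

lemma measure_bind_pmf:
  "measure_pmf.prob (bind_pmf p f) A = measure_pmf.expectation p (\<lambda>w. measure_pmf.prob (f w) A)"
proof -
  have "ennreal (measure_pmf.prob (bind_pmf p f) A) = (\<integral>\<^sup>+w. measure_pmf.prob (f w) A \<partial>measure_pmf p)"
    by (simp add: measure_pmf.emeasure_eq_measure[symmetric])
  also have "\<dots> = ennreal (measure_pmf.expectation p (\<lambda>w. measure_pmf.prob (f w) A))"
    by (rule nn_integral_eq_integral)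
       (auto intro!: measure_pmf.integrable_const_bound[where B = 1])
  finally show ?thesis by (simp add: integral_nonneg_AE)
qed

lemma prob_walk_hits: "measure_pmf.prob (walk_pmf G n y) {l. x \<in> set l} = hit_within G x n y"
proof (induction n arbitrary: y)
  case 0
  then show ?case by (auto simp: measure_return_pmf indicator_def)
next
  case (Suc n)
  have *: "measure_pmf.prob (walk_pmf G (Suc n) y) {l. x \<in> set l} =
      measure_pmf.expectation (srw_step G y)
        (\<lambda>w. measure_pmf.prob (walk_pmf G n w) {l. y = x \<or> x \<in> set l})"
    by (auto simp: measure_bind_pmf vimage_def intro!: Bochner_Integration.integral_cong
        arg_cong[where f = "measure_pmf.prob _"])
  show ?case
  proof (cases "y = x")
    case True
    then show ?thesis unfolding * by simp
  next
    case False
    then show ?thesis unfolding * by (simp add: Suc.IH)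
  qed
qed

text \<open>Returning takes one step and then a visit to \<open>x\<close>; the probability of a visit within \<open>n\<close> further
  steps increases to that of a visit at any time.\<close>

lemma return_prob_limit:
  fixes x :: "'a :: countable"
  shows "(\<lambda>n. measure_pmf.expectation (srw_step G x) (hit_within G x n)) \<longlonglongrightarrow> return_prob G x"
proof -
  interpret prob_space "srw_space G"
    unfolding srw_space_def
    by (rule prob_space_PiM) (auto simp: measure_pmf.prob_space_axioms split: prod.splits)
  define A where "A = (\<lambda>n. {\<sigma> \<in> space (srw_space G). \<exists>k\<in>{1..Suc n}. srw x \<sigma> k = x})"
  have meas: "A n \<in> events" for n
  proof -
    have "{\<sigma> \<in> space (srw_space G). srw x \<sigma> k = x} \<in> events" for k
      using measurable_sets[OF measurable_srw, of "{x}"]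
      by (simp add: vimage_def Int_def conj_commute)
    then show ?thesis unfolding A_def by measurable
  qed
  have "prob (A n) = measure_pmf.expectation (srw_step G x) (hit_within G x n)" for n
  proof -
    have "(\<exists>k\<in>{1..Suc n}. srw x \<sigma> k = x) \<longleftrightarrow> x \<in> set (tl (map (srw x \<sigma>) [0..<Suc (Suc n)]))" for \<sigma>
    proof -
      have "tl (map (srw x \<sigma>) [0..<Suc (Suc n)]) = map (srw x \<sigma>) [1..<Suc (Suc n)]"
        by (simp add: upt_rec del: upt_Suc)
      then have "set (tl (map (srw x \<sigma>) [0..<Suc (Suc n)])) = srw x \<sigma> ` {1..Suc n}"
        by (simp only: set_map set_upt atLeastLessThanSuc_atLeastAtMost)
      then show ?thesis by (metis image_iff)
    qed
    then have "prob (A n) = measure_pmf.prob (walk_pmf G (Suc n) x) {l. x \<in> set (tl l)}"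
      unfolding A_def using srw_distribution[of G "\<lambda>l. x \<in> set (tl l)" x "Suc n"] by simp
    then show ?thesis
      by (simp add: measure_bind_pmf vimage_def prob_walk_hits)
  qed
  moreover have "(\<lambda>n. prob (A n)) \<longlonglongrightarrow> prob (\<Union>n. A n)"
  proof (rule finite_Lim_measure_incseq)
    show "range A \<subseteq> events" using meas by blast
    show "incseq A"
    proof (rule incseq_SucI, rule subsetI)
      fix n \<sigma> assume "\<sigma> \<in> A n"
      then obtain k where "\<sigma> \<in> space (srw_space G)" "k \<in> {1..Suc n}" "srw x \<sigma> k = x"
        unfolding A_def by blast
      then show "\<sigma> \<in> A (Suc n)"
        unfolding A_def by (intro CollectI conjI bexI[of _ k]) auto
    qed
  qed
  moreover have "(\<Union>n. A n) = {\<sigma> \<in> space (srw_space G). \<exists>n\<ge>1. srw x \<sigma> n = x}"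
  proof (intro set_eqI iffI)
    fix \<sigma> assume "\<sigma> \<in> {\<sigma> \<in> space (srw_space G). \<exists>n\<ge>1. srw x \<sigma> n = x}"
    then obtain n where "\<sigma> \<in> space (srw_space G)" "n \<ge> 1" "srw x \<sigma> n = x" by blast
    then have "\<sigma> \<in> A n"
      unfolding A_def by (intro CollectI conjI bexI[of _ n]) auto
    then show "\<sigma> \<in> (\<Union>n. A n)" by blast
  qed (auto simp: A_def simp del: srw.simps)
  ultimately show ?thesis
    by (simp add: return_prob_def)
qed

section \<open>Dirichlet energy\<close>

definition laplacian :: "'a ugraph \<Rightarrow> ('a \<Rightarrow> real) \<Rightarrow> 'a \<Rightarrow> real" where
  "laplacian G g u = (\<Sum>v\<in>neighbours G u. g u - g v)"

text \<open>Every edge is counted in both orientations, so this is twice the usual Dirichlet energy. Summing only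
  over pairs on which \<open>f\<close> changes keeps the sum finite for a finitely supported \<open>f\<close> on an infinite graph.\<close>

definition energy :: "'a ugraph \<Rightarrow> ('a \<Rightarrow> real) \<Rightarrow> real" where
  "energy G f = (\<Sum>(u, v) \<in> {(u, v). {u, v} \<in> edges G \<and> f u \<noteq> f v}. (f u - f v)\<^sup>2)"

abbreviation finite_support :: "('a \<Rightarrow> real) \<Rightarrow> bool" where
  "finite_support f \<equiv> finite {v. f v \<noteq> 0}"

definition arcs_at :: "'a ugraph \<Rightarrow> 'a set \<Rightarrow> ('a \<times> 'a) set" where
  "arcs_at G T = {(u, v). {u, v} \<in> edges G \<and> (u \<in> T \<or> v \<in> T)}"

lemma neighbours_sym: "v \<in> neighbours G u \<longleftrightarrow> u \<in> neighbours G v"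
  by (simp add: neighbours_def insert_commute)

lemma finite_neighbours:
  assumes "simple_graph G" "locally_finite G"
  shows "finite (neighbours G v)"
proof (cases "v \<in> verts G")
  case False
  then have "neighbours G v = {}"
    using assms(1) by (auto simp: neighbours_def simple_graph_def)
  then show ?thesis by simp
qed (use assms(2) in \<open>auto simp: locally_finite_def\<close>)

lemma finite_arcs_at:
  assumes "\<And>v. finite (neighbours G v)" "finite T"
  shows "finite (arcs_at G T)"
proof (rule finite_subset)
  show "arcs_at G T \<subseteq> Sigma T (neighbours G) \<union> prod.swap ` Sigma T (neighbours G)"
    by (auto simp: arcs_at_def neighbours_def insert_commute image_iff)
qed (use assms in auto)

lemma energy_eq_sum:
  assumes "\<And>v. finite (neighbours G v)" "finite T" "{v. f v \<noteq> 0} \<subseteq> T"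
  shows "energy G f = (\<Sum>(u, v) \<in> arcs_at G T. (f u - f v)\<^sup>2)"
proof -
  have "{(u, v). {u, v} \<in> edges G \<and> f u \<noteq> f v} \<subseteq> arcs_at G T"
  proof clarify
    fix u v assume uv: "{u, v} \<in> edges G" "f u \<noteq> f v"
    then have "f u \<noteq> 0 \<or> f v \<noteq> 0" by auto
    then have "u \<in> T \<or> v \<in> T" using assms(3) by blast
    then show "(u, v) \<in> arcs_at G T" using uv by (simp add: arcs_at_def)
  qed
  then show ?thesis
    unfolding energy_def
    by (intro sum.mono_neutral_left) (use finite_arcs_at[OF assms(1,2)] in \<open>auto simp: arcs_at_def\<close>)
qed

lemma energy_nonneg: "energy G f \<ge> 0"
  unfolding energy_def by (rule sum_nonneg) auto

lemma sum_le_energy: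
  assumes "\<And>v. finite (neighbours G v)" "finite_support f"
    and "finite A" "\<And>u v. (u, v) \<in> A \<Longrightarrow> {u, v} \<in> edges G"
  shows "(\<Sum>(u, v) \<in> A. (f u - f v)\<^sup>2) \<le> energy G f"
proof -
  let ?D = "{(u, v). {u, v} \<in> edges G \<and> f u \<noteq> f v}"
  have "finite ?D"
    by (rule finite_subset[OF _ finite_arcs_at[OF assms(1,2)]]) (auto simp: arcs_at_def)
  have "(\<Sum>(u, v) \<in> A. (f u - f v)\<^sup>2) = (\<Sum>(u, v) \<in> A \<inter> ?D. (f u - f v)\<^sup>2)"
    by (rule sum.mono_neutral_right) (use assms(3,4) in auto)
  also have "\<dots> \<le> energy G f"
    unfolding energy_def by (rule sum_mono2) (use \<open>finite ?D\<close> in auto)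
  finally show ?thesis .
qed

text \<open>Summation by parts: exchanging the two orientations of each edge turns the terms with \<open>f v\<close> into
  terms with \<open>f u\<close>, and these vanish for \<open>u\<close> outside \<open>T\<close>.\<close>

lemma green_identity:
  assumes nb: "\<And>v. finite (neighbours G v)" and T: "finite T" "{v. f v \<noteq> 0} \<subseteq> T"
  shows "(\<Sum>(u, v) \<in> arcs_at G T. (f u - f v) * (g u - g v)) = 2 * (\<Sum>u\<in>T. f u * laplacian G g u)"
proof -
  let ?A = "arcs_at G T"
  let ?S = "\<Sum>(u, v) \<in> ?A. f u * (g u - g v)"
  have fin: "finite ?A" by (rule finite_arcs_at[OF nb T(1)])
  have swap: "prod.swap ` ?A = ?A"
    by (force simp: arcs_at_def insert_commute image_iff)
  have "?S = (\<Sum>(u, v) \<in> prod.swap ` ?A. f u * (g u - g v))"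
    by (simp add: swap)
  also have "\<dots> = (\<Sum>(u, v) \<in> ?A. f v * (g v - g u))"
    by (subst sum.reindex) (auto simp: case_prod_beta)
  finally have S2: "?S = (\<Sum>(u, v) \<in> ?A. f v * (g v - g u))" .
  have "(\<Sum>(u, v) \<in> ?A. (f u - f v) * (g u - g v)) =
      (\<Sum>(u, v) \<in> ?A. f u * (g u - g v) + f v * (g v - g u))"
    by (intro sum.cong) (auto simp: algebra_simps)
  also have "\<dots> = ?S + (\<Sum>(u, v) \<in> ?A. f v * (g v - g u))"
    by (simp add: case_prod_beta sum.distrib)
  also have "\<dots> = 2 * ?S" using S2 by simp
  also have "?S = (\<Sum>(u, v) \<in> Sigma T (neighbours G). f u * (g u - g v))"
    by (rule sum.mono_neutral_right) (use fin T in \<open>auto simp: arcs_at_def neighbours_def\<close>)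
  also have "\<dots> = (\<Sum>u\<in>T. f u * laplacian G g u)"
    using T nb by (subst sum.Sigma[symmetric]) (auto simp: laplacian_def sum_distrib_left)
  finally show ?thesis .
qed

lemma hit_within_self [simp]: "hit_within G x n x = 1"
  by (cases n) auto

lemma expectation_srw_step:
  fixes g :: "'a \<Rightarrow> real"
  assumes "finite (neighbours G y)"
  shows "measure_pmf.expectation (srw_step G y) g =
    (if neighbours G y = {} then g y else sum g (neighbours G y) / card (neighbours G y))"
  using assms by (simp add: srw_step_def integral_pmf_of_set)

context
  fixes G :: "'a ugraph" and x :: 'a
  assumes nb: "\<And>v. finite (neighbours G v)"
begin

lemma expectation_srw_step_mono:
  fixes g h :: "'a \<Rightarrow> real"
  assumes "\<And>v. g v \<le> h v"
  shows "measure_pmf.expectation (srw_step G y) g \<le> measure_pmf.expectation (srw_step G y) h"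
  using assms by (auto simp: expectation_srw_step[OF nb] intro!: divide_right_mono sum_mono)

lemma hit_within_nonneg: "hit_within G x n y \<ge> 0"
  by (induction n arbitrary: y) (auto intro: integral_nonneg_AE)

lemma hit_within_le_1: "hit_within G x n y \<le> 1"
proof (induction n arbitrary: y)
  case (Suc n)
  have "measure_pmf.expectation (srw_step G y) (hit_within G x n) \<le>
      measure_pmf.expectation (srw_step G y) (\<lambda>_. 1)"
    by (rule expectation_srw_step_mono) (rule Suc.IH)
  then show ?case by simp
qed simp

lemma hit_within_mono: "hit_within G x n y \<le> hit_within G x (Suc n) y"
proof (induction n arbitrary: y)
  case 0
  then show ?case
    using hit_within_nonneg[of "Suc 0" y] by (cases "y = x") auto
next
  case (Suc n)
  have "measure_pmf.expectation (srw_step G y) (hit_within G x n) \<le>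
      measure_pmf.expectation (srw_step G y) (hit_within G x (Suc n))"
    by (rule expectation_srw_step_mono) (rule Suc.IH)
  then show ?case by simp
qed

lemma hit_within_finite_support: "finite_support (hit_within G x n)"
proof (induction n)
  case (Suc n)
  have "{y. hit_within G x (Suc n) y \<noteq> 0} \<subseteq>
      insert x ({y. hit_within G x n y \<noteq> 0} \<union> (\<Union>w\<in>{y. hit_within G x n y \<noteq> 0}. neighbours G w))"
  proof
    fix y assume y: "y \<in> {y. hit_within G x (Suc n) y \<noteq> 0}"
    show "y \<in> insert x ({y. hit_within G x n y \<noteq> 0} \<union>
        (\<Union>w\<in>{y. hit_within G x n y \<noteq> 0}. neighbours G w))"
    proof (rule ccontr)
      assume a: "\<not> ?thesis"
      then have "\<forall>w\<in>neighbours G y. hit_within G x n w = 0"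
        using neighbours_sym[of _ G y] by blast
      with a y show False
        by (auto simp: expectation_srw_step[OF nb] split: if_splits)
    qed
  qed
  then show ?case
    by (rule finite_subset) (use Suc nb in auto)
qed simp

text \<open>By the recursion at the first step, \<open>hit_within G x n\<close> is subharmonic off \<open>x\<close>, and up to the degree its
  Laplacian at \<open>x\<close> is the probability of not returning within \<open>n + 1\<close> steps. This is how the energy
  sees the return probability.\<close>

lemma laplacian_hit_within:
  "laplacian G (hit_within G x n) y = card (neighbours G y) *
     (hit_within G x n y - (if y = x then measure_pmf.expectation (srw_step G x) (hit_within G x n)
        else hit_within G x (Suc n) y))"
proof -
  have "laplacian G (hit_within G x n) y = card (neighbours G y) *
     (hit_within G x n y - measure_pmf.expectation (srw_step G y) (hit_within G x n))"
    using nb by (auto simp: laplacian_def expectation_srw_step sum_subtractf algebra_simps)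
  then show ?thesis by simp
qed

lemma energy_hit_within_le:
  "energy G (hit_within G x n) \<le>
    2 * card (neighbours G x) * (1 - measure_pmf.expectation (srw_step G x) (hit_within G x n))"
proof -
  let ?R = "hit_within G x n"
  define T where "T = {v. ?R v \<noteq> 0}"
  have T: "finite T" "x \<in> T"
    using hit_within_finite_support by (auto simp: T_def)
  have "energy G ?R = 2 * (\<Sum>u\<in>T. ?R u * laplacian G ?R u)"
    using green_identity[OF nb T(1), of ?R ?R] energy_eq_sum[OF nb T(1), of ?R]
    by (simp add: T_def power2_eq_square)
  also have "(\<Sum>u\<in>T. ?R u * laplacian G ?R u) =
      ?R x * laplacian G ?R x + (\<Sum>u\<in>T - {x}. ?R u * laplacian G ?R u)"
    by (rule sum.remove[OF T])
  also have "(\<Sum>u\<in>T - {x}. ?R u * laplacian G ?R u) \<le> 0"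
  proof (rule sum_nonpos)
    fix u assume "u \<in> T - {x}"
    then have "laplacian G ?R u \<le> 0"
      using hit_within_mono[of n u]
      by (auto simp: laplacian_hit_within mult_nonneg_nonpos simp del: hit_within.simps)
    then show "?R u * laplacian G ?R u \<le> 0"
      by (simp add: mult_nonneg_nonpos hit_within_nonneg)
  qed
  finally show ?thesis
    by (simp add: laplacian_hit_within algebra_simps)
qed

end

text \<open>The function \<open>hit_within G x n\<close> has value 1 at \<open>x\<close>, and its energy is at most a multiple of the
  probability of not returning within \<open>n + 1\<close> steps. If this probability tended to 0, the energy
  would violate the bound.\<close>

theorem return_prob_less_1_of_energy_bound:
  fixes G :: "'a :: countable ugraph"
  assumes nb: "\<And>v. finite (neighbours G v)"
    and bound: "\<And>f. finite_support f \<Longrightarrow> (f x)\<^sup>2 \<le> C * energy G f"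
    and "C \<ge> 0"
  shows "return_prob G x < 1"
proof -
  let ?r = "\<lambda>n. measure_pmf.expectation (srw_step G x) (hit_within G x n)"
  let ?K = "C * (2 * card (neighbours G x))"
  have "1 \<le> ?K * (1 - ?r n)" for n
  proof -
    have "1 \<le> C * energy G (hit_within G x n)"
      using bound[OF hit_within_finite_support[OF nb], of x n] by simp
    also have "\<dots> \<le> C * (2 * card (neighbours G x) * (1 - ?r n))"
      using energy_hit_within_le[OF nb] \<open>C \<ge> 0\<close> by (intro mult_left_mono)
    finally show ?thesis by (simp add: mult_ac)
  qed
  moreover have "(\<lambda>n. ?K * (1 - ?r n)) \<longlonglongrightarrow> ?K * (1 - return_prob G x)"
    by (intro tendsto_intros return_prob_limit)
  ultimately have "1 \<le> ?K * (1 - return_prob G x)"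
    by (intro LIMSEQ_le_const) auto
  moreover have "?K \<ge> 0" using \<open>C \<ge> 0\<close> by simp
  ultimately show ?thesis
    by (metis diff_gt_0_iff_gt mult_nonneg_nonpos not_less not_one_le_zero order_trans)
qed

text \<open>Pairing \<open>f m\<close> with \<open>hit_within G x n\<close> in the energy form gives, by summation by parts and as
  \<open>n \<rightarrow> \<infinity>\<close>, the product of \<open>f m x\<close>, the degree and the escape probability; by Cauchy-Schwarz the
  pairing is small together with the energy of \<open>f m\<close>.\<close>

theorem return_prob_eq_1_of_energy_tendsto_0:
  fixes G :: "'a :: countable ugraph" and f :: "nat \<Rightarrow> 'a \<Rightarrow> real"
  assumes nb: "\<And>v. finite (neighbours G v)"
    and supp: "\<And>m. finite_support (f m)"
    and lim: "(\<lambda>m. f m x) \<longlonglongrightarrow> 1" "(\<lambda>m. energy G (f m)) \<longlonglongrightarrow> 0"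
  shows "return_prob G x = 1"
proof -
  let ?r = "\<lambda>n. measure_pmf.expectation (srw_step G x) (hit_within G x n)"
  let ?R = "hit_within G x"
  let ?d = "\<lambda>y. real (card (neighbours G y))"
  have le1: "return_prob G x \<le> 1"
  proof (rule LIMSEQ_le_const2[OF return_prob_limit])
    show "\<exists>N. \<forall>n\<ge>N. ?r n \<le> 1"
      using expectation_srw_step_mono[OF nb, of "?R n" "\<lambda>_. 1" x for n] hit_within_le_1[OF nb, of x] by auto
  qed
  have key: "2 * (f m x * ?d x * (1 - return_prob G x)) \<le> sqrt (energy G (f m)) * sqrt (2 * ?d x)" for m
  proof -
    define T where "T = insert x {v. f m v \<noteq> 0}"
    have T: "finite T" "x \<in> T" "{v. f m v \<noteq> 0} \<subseteq> T" using supp by (auto simp: T_def)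
    \<comment> \<open>Off \<open>x\<close> the Laplacian is an increment of a bounded monotone sequence, hence vanishes in the limit.\<close>
    have conv: "convergent (\<lambda>n. ?R n u)" for u
    proof (rule Bseq_mono_convergent)
      show "Bseq (\<lambda>n. ?R n u)"
        using hit_within_nonneg[OF nb] hit_within_le_1[OF nb] by (intro BseqI'[where K = 1]) auto
      show "\<forall>m n. m \<le> n \<longrightarrow> ?R m u \<le> ?R n u"
        using lift_Suc_mono_le[of "\<lambda>n. ?R n u"] hit_within_mono[OF nb] by blast
    qed
    have diff0: "(\<lambda>n. ?R n u - ?R (Suc n) u) \<longlonglongrightarrow> 0" for u
    proof -
      obtain L where "(\<lambda>n. ?R n u) \<longlonglongrightarrow> L" using conv by (auto simp: convergent_def)
      from tendsto_diff[OF this LIMSEQ_Suc[OF this]] show ?thesis by simp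
    qed
    have "(\<lambda>n. 2 * (\<Sum>u\<in>T. f m u * laplacian G (?R n) u))
        \<longlonglongrightarrow> 2 * (f m x * (?d x * (1 - return_prob G x)) + (\<Sum>u\<in>T - {x}. f m u * (?d u * 0)))"
    proof (subst sum.remove[OF T(1,2)], intro tendsto_intros)
      show "(\<lambda>n. laplacian G (?R n) x) \<longlonglongrightarrow> ?d x * (1 - return_prob G x)"
        unfolding laplacian_hit_within[OF nb] by (auto intro!: tendsto_intros return_prob_limit)
      show "(\<lambda>n. laplacian G (?R n) u) \<longlonglongrightarrow> ?d u * 0" if "u \<in> T - {x}" for u
        using that diff0 unfolding laplacian_hit_within[OF nb]
        by (auto intro!: tendsto_mult_right_zero simp del: hit_within.simps)
    qed
    moreover have "2 * (\<Sum>u\<in>T. f m u * laplacian G (?R n) u) \<le> sqrt (energy G (f m)) * sqrt (2 * ?d x)" for n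
    proof -
      define S where "S = T \<union> {v. ?R n v \<noteq> 0}"
      have S: "finite S" "{v. f m v \<noteq> 0} \<subseteq> S" "{v. ?R n v \<noteq> 0} \<subseteq> S"
        using T hit_within_finite_support[OF nb] by (auto simp: S_def)
      have "2 * (\<Sum>u\<in>T. f m u * laplacian G (?R n) u) = 2 * (\<Sum>u\<in>S. f m u * laplacian G (?R n) u)"
        using S T by (auto simp: S_def intro!: sum.mono_neutral_left)
      also have "\<dots> = (\<Sum>(u, v) \<in> arcs_at G S. (f m u - f m v) * (?R n u - ?R n v))"
        by (rule green_identity[OF nb S(1,2), symmetric])
      also have "\<dots> \<le> sqrt ((\<Sum>(u, v) \<in> arcs_at G S. (f m u - f m v) * (?R n u - ?R n v))\<^sup>2)"
        by simp
      also have "\<dots> \<le> sqrt (energy G (f m) * energy G (?R n))"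
        unfolding energy_eq_sum[OF nb S(1,2)] energy_eq_sum[OF nb S(1,3)] case_prod_beta
        by (intro real_sqrt_le_mono Cauchy_Schwarz_ineq_sum)
      also have "\<dots> \<le> sqrt (energy G (f m) * (2 * ?d x))"
      proof (intro real_sqrt_le_mono mult_left_mono energy_nonneg)
        have "0 \<le> ?r n"
          using hit_within_nonneg[OF nb] by (intro integral_nonneg_AE) auto
        then have "2 * ?d x * (1 - ?r n) \<le> 2 * ?d x * 1"
          by (intro mult_left_mono) auto
        then show "energy G (?R n) \<le> 2 * ?d x"
          using energy_hit_within_le[OF nb, of x n] by simp
      qed
      finally show ?thesis by (simp add: real_sqrt_mult)
    qed
    ultimately show ?thesis
      using LIMSEQ_le_const2 by (fastforce simp: mult.assoc)
  qed
  have "2 * (1 * ?d x * (1 - return_prob G x)) \<le> sqrt 0 * sqrt (2 * ?d x)"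
  proof (rule LIMSEQ_le)
    show "(\<lambda>m. 2 * (f m x * ?d x * (1 - return_prob G x))) \<longlonglongrightarrow> 2 * (1 * ?d x * (1 - return_prob G x))"
      by (intro tendsto_intros lim)
    show "(\<lambda>m. sqrt (energy G (f m)) * sqrt (2 * ?d x)) \<longlonglongrightarrow> sqrt 0 * sqrt (2 * ?d x)"
      by (intro tendsto_intros lim)
  qed (use key in auto)
  then have "?d x * (1 - return_prob G x) \<le> 0" by (simp add: mult.commute)
  moreover have "return_prob G x = 1" if "?d x = 0"
  proof -
    have "neighbours G x = {}" using that nb by simp
    then have "?r n = 1" for n by (simp add: expectation_srw_step)
    then show ?thesis using return_prob_limit[of G x] by (simp add: LIMSEQ_const_iff)
  qed
  ultimately show ?thesis
    using le1 by (cases "?d x = 0") (auto simp: mult_le_0_iff)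
qed

section \<open>Connectedness and transience\<close>

lemma reachable_sym:
  assumes "reachable G u v"
  shows "reachable G v u"
  using assms unfolding reachable_def
proof (induction rule: rtranclp_induct)
  case (step v w)
  then have "{w, v} \<in> edges G" by (simp add: insert_commute)
  then show ?case using step.IH by (rule converse_rtranclp_into_rtranclp)
qed simp

lemma reachable_trans: "reachable G u v \<Longrightarrow> reachable G v w \<Longrightarrow> reachable G u w"
  unfolding reachable_def by (rule rtranclp_trans)

lemma reachable_edge: "{u, v} \<in> edges G \<Longrightarrow> reachable G u v"
  unfolding reachable_def by (rule r_into_rtranclp)

lemma reachable_mono:
  assumes "edges G \<subseteq> edges G'" "reachable G u v"
  shows "reachable G' u v"
  using assms(2) unfolding reachable_def by (rule rtranclp_mono[THEN predicate2D, rotated]) (use assms(1) in auto)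

lemma adjacent_diff_le:
  assumes "\<And>v. finite (neighbours G v)" "finite_support f" "{u, v} \<in> edges G"
  shows "\<bar>f u - f v\<bar> \<le> sqrt (energy G f)"
proof -
  have "(f u - f v)\<^sup>2 \<le> energy G f"
    using sum_le_energy[OF assms(1,2), of "{(u, v)}"] assms(3) by simp
  then show ?thesis
    using real_le_rsqrt by fastforce
qed

lemma reachable_diff_le:
  assumes nb: "\<And>v. finite (neighbours G v)" and "reachable G u v"
  shows "\<exists>C\<ge>0. \<forall>f. finite_support f \<longrightarrow> \<bar>f u - f v\<bar> \<le> C * sqrt (energy G f)"
  using assms(2) unfolding reachable_def
proof (induction rule: rtranclp_induct)
  case base
  then show ?case by (auto intro!: exI[of _ 0])
next
  case (step v w)
  then obtain C where C: "C \<ge> 0" "\<And>f. finite_support f \<Longrightarrow> \<bar>f u - f v\<bar> \<le> C * sqrt (energy G f)"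
    by blast
  have "\<bar>f u - f w\<bar> \<le> (C + 1) * sqrt (energy G f)" if "finite_support f" for f
    using C(2)[OF that] adjacent_diff_le[OF nb that step(2)] by (simp add: algebra_simps)
  then show ?case
    using C(1) by (intro exI[of _ "C + 1"]) auto
qed

text \<open>Along a path of length \<open>D\<close> the values of \<open>f\<close> change by at most \<open>D\<close> times the root of the energy, so in
  a connected graph an energy bound at one vertex gives one at every vertex.\<close>

theorem transient_of_energy_bound:
  fixes G :: "'a :: countable ugraph"
  assumes nb: "\<And>v. finite (neighbours G v)" and conn: "connected_graph G"
    and x: "x \<in> verts G" "C \<ge> 0" "\<And>f. finite_support f \<Longrightarrow> \<bar>f x\<bar> \<le> C * sqrt (energy G f)"
  shows "transient G"
  unfolding transient_def
proof (intro conjI ballI conn)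
  fix y assume "y \<in> verts G"
  then have "reachable G y x"
    using conn x(1) by (auto simp: connected_graph_def)
  then obtain D where D: "D \<ge> 0" "\<And>f. finite_support f \<Longrightarrow> \<bar>f y - f x\<bar> \<le> D * sqrt (energy G f)"
    using reachable_diff_le[OF nb] by blast
  have "(f y)\<^sup>2 \<le> (D + C)\<^sup>2 * energy G f" if "finite_support f" for f
  proof -
    have "\<bar>f y\<bar> \<le> (D + C) * sqrt (energy G f)"
      using D(2)[OF that] x(3)[OF that] by (simp add: algebra_simps)
    then have "\<bar>f y\<bar>\<^sup>2 \<le> ((D + C) * sqrt (energy G f))\<^sup>2"
      by (intro power_mono) auto
    then show ?thesis
      by (simp add: power_mult_distrib energy_nonneg)
  qed
  then show "return_prob G y < 1"
    by (rule return_prob_less_1_of_energy_bound[OF nb]) auto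
qed

section \<open>Means along disjoint lines\<close>

definition mean :: "'t set \<Rightarrow> ('t \<Rightarrow> real) \<Rightarrow> real" where
  "mean A g = sum g A / card A"

lemma mean_le:
  assumes "finite A" "A \<noteq> {}" "\<And>x. x \<in> A \<Longrightarrow> g x \<le> c"
  shows "mean A g \<le> c"
  using sum_bounded_above[of A g c] assms card_gt_0_iff[of A]
  by (simp add: mean_def divide_le_eq mult.commute)

lemma mean_ge:
  assumes "finite A" "A \<noteq> {}" "\<And>x. x \<in> A \<Longrightarrow> c \<le> g x"
  shows "c \<le> mean A g"
  using sum_bounded_below[of A c g] assms card_gt_0_iff[of A]
  by (simp add: mean_def le_divide_eq mult.commute)

lemma mean_diff_le:
  assumes A: "finite A" "A \<noteq> {}" and B: "finite B" "B \<noteq> {}"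
    and le: "\<And>a b. a \<in> A \<Longrightarrow> b \<in> B \<Longrightarrow> \<bar>g a - h b\<bar> \<le> K"
  shows "\<bar>mean A g - mean B h\<bar> \<le> K"
proof -
  have "mean A g \<le> h b + K" if "b \<in> B" for b
    using le[OF _ that] by (intro mean_le A) (smt (verit, best))
  then have "mean A g - K \<le> mean B h"
    by (intro mean_ge B) (smt (verit, best))
  moreover have "h b - K \<le> mean A g" if "b \<in> B" for b
    using le[OF _ that] by (intro mean_ge A) (smt (verit, best))
  then have "mean B h \<le> mean A g + K"
    by (intro mean_le B) (smt (verit, best))
  ultimately show ?thesis by linarith
qed

lemma mean_Times: "mean (A \<times> B) (\<lambda>(a, b). g a b) = mean A (\<lambda>a. mean B (g a))"
  by (simp add: mean_def sum.cartesian_product[symmetric] card_cartesian_product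
      sum_divide_distrib[symmetric] mult.commute)

lemma mean_swap: "mean A (\<lambda>a. mean B (g a)) = mean B (\<lambda>b. mean A (\<lambda>a. g a b))"
proof -
  have "(\<Sum>a\<in>A. \<Sum>b\<in>B. g a b) = (\<Sum>b\<in>B. \<Sum>a\<in>A. g a b)" by (rule sum.swap)
  then show ?thesis
    by (simp add: mean_def sum_divide_distrib[symmetric] mult.commute)
qed

lemma line_diff_le:
  fixes g :: "nat \<Rightarrow> real"
  assumes "a \<le> n" "b \<le> n"
  shows "\<bar>g a - g b\<bar> \<le> (\<Sum>s<n. \<bar>g s - g (Suc s)\<bar>)"
proof -
  have *: "\<bar>g a - g b\<bar> \<le> (\<Sum>s<n. \<bar>g s - g (Suc s)\<bar>)" if "a \<le> b" "b \<le> n" for a b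
  proof -
    have "\<bar>g b - g a\<bar> = \<bar>\<Sum>s=a..<b. g (Suc s) - g s\<bar>"
      using that(1) by (simp add: sum_Suc_diff')
    also have "\<dots> \<le> (\<Sum>s=a..<b. \<bar>g (Suc s) - g s\<bar>)" by (rule sum_abs)
    also have "\<dots> \<le> (\<Sum>s<n. \<bar>g (Suc s) - g s\<bar>)"
      by (rule sum_mono2) (use that in auto)
    finally show ?thesis by (simp add: abs_minus_commute)
  qed
  show ?thesis
    using *[of a b] *[of b a] assms by (cases "a \<le> b") (auto simp: abs_minus_commute)
qed

text \<open>Disjoint lines use distinct edges, so their squared increments sum up to at most the energy;
  Cauchy-Schwarz then costs the root of the number \<open>n * card T\<close> of edges.\<close>

lemma sum_lines_le:
  assumes nb: "\<And>v. finite (neighbours G v)" and f: "finite_support f" and T: "finite T"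
    and line: "\<And>t s. t \<in> T \<Longrightarrow> s < n \<Longrightarrow> {l t s, l t (Suc s)} \<in> edges G"
    and inj: "inj_on (\<lambda>(t, s). l t s) (T \<times> {..n})"
  shows "(\<Sum>t\<in>T. \<Sum>s<n. \<bar>f (l t s) - f (l t (Suc s))\<bar>) \<le> sqrt (real n * card T) * sqrt (energy G f)"
proof -
  let ?P = "T \<times> {..<n}"
  let ?D = "\<lambda>p. \<bar>f (l (fst p) (snd p)) - f (l (fst p) (Suc (snd p)))\<bar>"
  let ?h = "\<lambda>p. (l (fst p) (snd p), l (fst p) (Suc (snd p)))"
  have "inj_on ?h ?P"
    using inj by (fastforce simp: inj_on_def)
  then have "(\<Sum>p\<in>?P. (?D p)\<^sup>2) = (\<Sum>(u, v)\<in>?h ` ?P. (f u - f v)\<^sup>2)"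
    by (simp add: sum.reindex)
  also have "\<dots> \<le> energy G f"
    by (rule sum_le_energy[OF nb f]) (use T line in auto)
  finally have E: "(\<Sum>p\<in>?P. (?D p)\<^sup>2) \<le> energy G f" .
  have "(\<Sum>p\<in>?P. 1 * ?D p)\<^sup>2 \<le> (\<Sum>p\<in>?P. 1\<^sup>2) * (\<Sum>p\<in>?P. (?D p)\<^sup>2)"
    by (rule Cauchy_Schwarz_ineq_sum)
  also have "\<dots> \<le> (real n * card T) * energy G f"
    using mult_left_mono[OF E, of "real n * card T"] by (simp add: card_cartesian_product mult_ac)
  finally have "(\<Sum>p\<in>?P. ?D p) \<le> sqrt ((real n * card T) * energy G f)"
    by (intro real_le_rsqrt) simp
  moreover have "(\<Sum>t\<in>T. \<Sum>s<n. \<bar>f (l t s) - f (l t (Suc s))\<bar>) = (\<Sum>p\<in>?P. ?D p)"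
    by (simp add: sum.cartesian_product case_prod_beta)
  ultimately show ?thesis by (simp only: real_sqrt_mult)
qed

text \<open>Moving mass along \<open>card T\<close> disjoint lines of length \<open>n\<close>, from any positions on each line to any
  other positions on the same line, changes the mean of \<open>f\<close> by at most \<open>sqrt (n / card T)\<close> times the root of the
  energy. The resistance of \<open>N\<close> parallel wires of length \<open>n\<close> is \<open>n / N\<close>.\<close>

lemma mean_lines_diff_le:
  assumes nb: "\<And>v. finite (neighbours G v)" and f: "finite_support f" and T: "finite T" "T \<noteq> {}"
    and line: "\<And>t s. t \<in> T \<Longrightarrow> s < n \<Longrightarrow> {l t s, l t (Suc s)} \<in> edges G"
    and inj: "inj_on (\<lambda>(t, s). l t s) (T \<times> {..n})"
    and A: "finite A" "A \<noteq> {}" "\<And>t x. t \<in> T \<Longrightarrow> x \<in> A \<Longrightarrow> a t x \<le> n"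
    and B: "finite B" "B \<noteq> {}" "\<And>t x. t \<in> T \<Longrightarrow> x \<in> B \<Longrightarrow> b t x \<le> n"
    and ratio: "real n / card T \<le> c\<^sup>2" "c \<ge> 0"
  shows "\<bar>mean T (\<lambda>t. mean A (\<lambda>x. f (l t (a t x)))) - mean T (\<lambda>t. mean B (\<lambda>x. f (l t (b t x))))\<bar>
    \<le> c * sqrt (energy G f)"
proof -
  let ?osc = "\<lambda>t. \<Sum>s<n. \<bar>f (l t s) - f (l t (Suc s))\<bar>"
  let ?F = "\<lambda>t. mean A (\<lambda>x. f (l t (a t x))) - mean B (\<lambda>x. f (l t (b t x)))"
  have N: "real (card T) > 0" using T by (simp add: card_gt_0_iff)
  have osc: "\<bar>?F t\<bar> \<le> ?osc t" if "t \<in> T" for t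
    using A B that by (intro mean_diff_le line_diff_le[where g = "\<lambda>s. f (l t s)"]) auto
  have "\<bar>mean T (\<lambda>t. mean A (\<lambda>x. f (l t (a t x)))) - mean T (\<lambda>t. mean B (\<lambda>x. f (l t (b t x))))\<bar>
      = \<bar>\<Sum>t\<in>T. ?F t\<bar> / card T"
    by (simp add: mean_def[of T] sum_subtractf diff_divide_distrib[symmetric])
  also have "\<dots> \<le> (\<Sum>t\<in>T. ?osc t) / card T"
    using osc by (intro divide_right_mono order.trans[OF sum_abs] sum_mono) auto
  also have "\<dots> \<le> (sqrt (real n * card T) * sqrt (energy G f)) / card T"
    by (intro divide_right_mono sum_lines_le[OF nb f T(1) line inj]) auto
  also have "\<dots> = sqrt (real n / card T) * sqrt (energy G f)"
    using N by (simp add: real_sqrt_mult real_sqrt_divide field_simps)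
  also have "\<dots> \<le> c * sqrt (energy G f)"
    using ratio by (intro mult_right_mono real_le_lsqrt) (auto simp: energy_nonneg)
  finally show ?thesis .
qed

section \<open>Transience of rooms with many doors\<close>

lemma block_less:
  fixes d :: nat
  assumes "i < 2 ^ k" "d < Suc i * 2 ^ k"
  shows "d < 4 ^ k"
proof -
  have "Suc i * 2 ^ k \<le> 2 ^ k * (2::nat) ^ k" using assms(1) by (intro mult_right_mono) auto
  also have "\<dots> = 4 ^ k" by (simp add: power_mult_distrib[symmetric])
  finally show ?thesis using assms(2) by linarith
qed

text \<open>Room \<open>k\<close> is the box \<open>{..<4 ^ k} \<times> {..<4 ^ k} \<times> {4 ^ k..<4 ^ Suc k}\<close>. The wall behind it is divided into
  \<open>2 ^ k\<close> times \<open>4 ^ k\<close> blocks, each of \<open>2 ^ k\<close> positions in a row in direction \<open>x\<close>; the block \<open>(i, j)\<close> has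
  a passage at \<open>x = door k i j\<close>, \<open>y = j\<close>. The assumptions concern the rooms from \<open>K\<close> on only, because
  percolation provides passages in all but finitely many walls.\<close>

locale rooms_with_doors =
  fixes G :: "'v ugraph" and pt :: "nat \<Rightarrow> nat \<Rightarrow> nat \<Rightarrow> 'v"
    and K :: nat and door :: "nat \<Rightarrow> nat \<Rightarrow> nat \<Rightarrow> nat"
  assumes nb: "\<And>v. finite (neighbours G v)"
    and pt_inj: "\<And>x y z x' y' z'. pt x y z = pt x' y' z' \<Longrightarrow> x = x' \<and> y = y' \<and> z = z'"
    and x_edge: "\<And>k x y z. K \<le> k \<Longrightarrow> Suc x < 4 ^ k \<Longrightarrow> y < 4 ^ k \<Longrightarrow> z \<in> {4 ^ k..<4 ^ Suc k} \<Longrightarrow>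
        {pt x y z, pt (Suc x) y z} \<in> edges G"
    and y_edge: "\<And>k x y z. K \<le> k \<Longrightarrow> x < 4 ^ k \<Longrightarrow> Suc y < 4 ^ k \<Longrightarrow> z \<in> {4 ^ k..<4 ^ Suc k} \<Longrightarrow>
        {pt x y z, pt x (Suc y) z} \<in> edges G"
    and z_edge: "\<And>k x y z. K \<le> k \<Longrightarrow> x < 4 ^ k \<Longrightarrow> y < 4 ^ k \<Longrightarrow> 4 ^ k \<le> z \<Longrightarrow> Suc z < 4 ^ Suc k \<Longrightarrow>
        {pt x y z, pt x y (Suc z)} \<in> edges G"
    and door_block: "\<And>k i j. K \<le> k \<Longrightarrow> i < 2 ^ k \<Longrightarrow> j < 4 ^ k \<Longrightarrow>
        i * 2 ^ k \<le> door k i j \<and> door k i j < Suc i * 2 ^ k"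
    and door_edge: "\<And>k i j. K \<le> k \<Longrightarrow> i < 2 ^ k \<Longrightarrow> j < 4 ^ k \<Longrightarrow>
        {pt (door k i j) j (4 ^ Suc k - 1), pt (door k i j) j (4 ^ Suc k)} \<in> edges G"
begin

definition room_mean :: "nat \<Rightarrow> ('v \<Rightarrow> real) \<Rightarrow> real" where
  "room_mean k f =
    mean {..<4 ^ k} (\<lambda>x. mean {..<4 ^ k} (\<lambda>y. mean {4 ^ k..<4 ^ Suc k} (\<lambda>z. f (pt x y z))))"

lemma door_less:
  assumes "K \<le> k" "i < 2 ^ k" "j < 4 ^ k"
  shows "door k i j < 4 ^ k"
  using block_less[OF assms(2)] door_block[OF assms] by blast

lemma door_inj:
  assumes "K \<le> k" "i < 2 ^ k" "j < 4 ^ k" "i' < 2 ^ k" "door k i j = door k i' j"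
  shows "i = i'"
proof -
  have "i = door k i j div 2 ^ k" if "i < 2 ^ k" for i
    using door_block[OF assms(1) that assms(3)]
    by (metis div_nat_eqI mult.commute)
  then show ?thesis using assms by metis
qed

lemma door_line_edge:
  assumes "K \<le> k" "i < 2 ^ k" "j < 4 ^ k" "4 ^ k \<le> z" "Suc z < 4 ^ Suc (Suc k)"
  shows "{pt (door k i j) j z, pt (door k i j) j (Suc z)} \<in> edges G"
proof -
  note less = door_less[OF assms(1-3)]
  consider "Suc z < 4 ^ Suc k" | "Suc z = 4 ^ Suc k" | "4 ^ Suc k \<le> z" by linarith
  then show ?thesis
  proof cases
    case 1
    then show ?thesis using z_edge[OF assms(1) less assms(3,4)] by simp
  next
    case 2
    then have "z = 4 ^ Suc k - 1" by simp
    then show ?thesis using door_edge[OF assms(1-3)] 2 by simp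
  next
    case 3
    then show ?thesis using z_edge[of "Suc k" "door k i j" j z] less assms by simp
  qed
qed

text \<open>The uniform distribution on room \<open>k\<close> is moved to that on room \<open>Suc k\<close> in four steps, each along
  lines in one direction: within room \<open>k\<close> in direction \<open>x\<close> to the positions of the doors, one for each block;
  through the wall in direction \<open>z\<close>; then in directions \<open>x\<close> and \<open>y\<close> to the full width of the
  next room. The second step uses one line for each of the \<open>8 ^ k\<close> doors, of length about \<open>15 * 4 ^ k\<close>, and is the
  most expensive one; the others have of the order of \<open>16 ^ k\<close> lines of length about \<open>4 ^ k\<close>. In
  units of \<open>sqrt ((1/2) ^ k)\<close> times the root of the energy, the four steps cost at most 1, 4, 1 and 1.\<close>

lemma room_mean_step:
  assumes f: "finite_support f" and k: "K \<le> k"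
  shows "\<bar>room_mean k f - room_mean (Suc k) f\<bar> \<le> 7 * sqrt ((1/2) ^ k) * sqrt (energy G f)"
proof -
  define m :: nat where "m = 4 ^ k"
  define q :: nat where "q = 2 ^ k"
  define Z where "Z = {m..<4 * m}"
  define Z' where "Z' = {4 * m..<16 * m}"
  define r where "r = sqrt ((1/2) ^ k)"
  have m: "m > 0" "q > 0" "m = q * q"
    by (auto simp: m_def q_def power_mult_distrib[symmetric])
  have r: "r \<ge> 0" "r\<^sup>2 = 1 / q" by (auto simp: r_def q_def power_one_over)
  have rm: "room_mean k f = mean {..<m} (\<lambda>x. mean {..<m} (\<lambda>y. mean Z (\<lambda>z. f (pt x y z))))"
    by (simp add: room_mean_def m_def Z_def)
  have rm': "room_mean (Suc k) f =
      mean {..<4 * m} (\<lambda>x. mean {..<4 * m} (\<lambda>y. mean Z' (\<lambda>z. f (pt x y z))))"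
    by (simp add: room_mean_def m_def Z'_def)
  have ratio: "real n / N \<le> 1 / q" if "n * q \<le> N" "N > 0" for n N :: nat
  proof -
    have "real n * real q \<le> real N" using that(1) by (metis of_nat_le_iff of_nat_mult)
    then show ?thesis using that(2) m(2) by (simp add: field_simps)
  qed
  have qm: "q \<le> m" using m by simp

  \<comment> \<open>Fix \<open>y\<close> and \<open>z\<close>: from the uniform distribution on the line in direction \<open>x\<close> to its doors.\<close>
  have 1: "\<bar>mean ({..<m} \<times> Z) (\<lambda>t. mean {..<m} (\<lambda>x. f (pt x (fst t) (snd t))))
      - mean ({..<m} \<times> Z) (\<lambda>t. mean {..<q} (\<lambda>i. f (pt (door k i (fst t)) (fst t) (snd t))))\<bar>
      \<le> r * sqrt (energy G f)"
  proof (rule mean_lines_diff_le[OF nb f, where n = "m - 1" and l = "\<lambda>t x. pt x (fst t) (snd t)"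
        and a = "\<lambda>t x. x" and b = "\<lambda>t i. door k i (fst t)"])
    show "{pt s (fst t) (snd t), pt (Suc s) (fst t) (snd t)} \<in> edges G"
      if "t \<in> {..<m} \<times> Z" "s < m - 1" for t s
      using that k by (intro x_edge[of k]) (auto simp: Z_def m_def)
    show "inj_on (\<lambda>(t, s). pt s (fst t) (snd t)) (({..<m} \<times> Z) \<times> {..m - 1})"
      by (auto simp: inj_on_def dest: pt_inj)
    show "door k i (fst t) \<le> m - 1" if "t \<in> {..<m} \<times> Z" "i \<in> {..<q}" for t i
      using that door_less[OF k, of i "fst t"] by (auto simp: m_def q_def)
    have "(m - 1) * q \<le> m * q" by simp
    also have "\<dots> \<le> m * (3 * m)" using qm by (intro mult_left_mono) auto
    finally show "real (m - 1) / card ({..<m} \<times> Z) \<le> r\<^sup>2"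
      unfolding r using m by (intro ratio) (auto simp: Z_def)
  qed (use m r in \<open>auto simp: Z_def lessThan_empty_iff\<close>)

  \<comment> \<open>Fix a door: through the wall, on a line that starts at height \<open>m\<close>. The truncated difference
    \<open>z - m\<close> is the position of height \<open>z\<close> on this line.\<close>
  have 2: "\<bar>mean ({..<q} \<times> {..<m}) (\<lambda>t. mean Z (\<lambda>z. f (pt (door k (fst t) (snd t)) (snd t) (m + (z - m)))))
      - mean ({..<q} \<times> {..<m}) (\<lambda>t. mean Z' (\<lambda>z. f (pt (door k (fst t) (snd t)) (snd t) (m + (z - m)))))\<bar>
      \<le> (4 * r) * sqrt (energy G f)"
  proof (rule mean_lines_diff_le[OF nb f, where n = "15 * m - 1"
        and l = "\<lambda>t s. pt (door k (fst t) (snd t)) (snd t) (m + s)"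
        and a = "\<lambda>t z. z - m" and b = "\<lambda>t z. z - m"])
    show "{pt (door k (fst t) (snd t)) (snd t) (m + s), pt (door k (fst t) (snd t)) (snd t) (m + Suc s)} \<in> edges G"
      if "t \<in> {..<q} \<times> {..<m}" "s < 15 * m - 1" for t s
      using that door_line_edge[OF k, of "fst t" "snd t" "m + s"] by (auto simp: m_def q_def)
    show "inj_on (\<lambda>(t, s). pt (door k (fst t) (snd t)) (snd t) (m + s)) (({..<q} \<times> {..<m}) \<times> {..15 * m - 1})"
    proof (rule inj_onI, clarsimp)
      fix i j s i' j' s' assume "i < q" "j < m" "i' < q"
        and "pt (door k i j) j (m + s) = pt (door k i' j') j' (m + s')"
      then show "i = i' \<and> j = j' \<and> s = s'"
        using door_inj[OF k, of i j i'] by (auto simp: m_def q_def dest!: pt_inj)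
    qed
    have "real (15 * m - 1) / card ({..<q} \<times> {..<m}) \<le> real (16 * m) / (q * m)"
      unfolding card_cartesian_product card_lessThan of_nat_mult[symmetric]
      by (intro divide_right_mono) auto
    also have "\<dots> = 16 * r\<^sup>2" unfolding r using m(1,2) by (simp add: field_simps)
    finally show "real (15 * m - 1) / card ({..<q} \<times> {..<m}) \<le> (4 * r)\<^sup>2"
      by (simp add: power_mult_distrib)
  qed (use m r in \<open>auto simp: Z_def Z'_def lessThan_empty_iff\<close>)

  \<comment> \<open>Fix \<open>y\<close> and \<open>z\<close>: from the doors to all of the width in direction \<open>x\<close>, now in the next room.\<close>
  have 3: "\<bar>mean ({..<m} \<times> Z') (\<lambda>t. mean {..<q} (\<lambda>i. f (pt (door k i (fst t)) (fst t) (snd t))))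
      - mean ({..<m} \<times> Z') (\<lambda>t. mean {..<4 * m} (\<lambda>x. f (pt x (fst t) (snd t))))\<bar>
      \<le> r * sqrt (energy G f)"
  proof (rule mean_lines_diff_le[OF nb f, where n = "4 * m - 1" and l = "\<lambda>t x. pt x (fst t) (snd t)"
        and b = "\<lambda>t x. x" and a = "\<lambda>t i. door k i (fst t)"])
    show "{pt s (fst t) (snd t), pt (Suc s) (fst t) (snd t)} \<in> edges G"
      if "t \<in> {..<m} \<times> Z'" "s < 4 * m - 1" for t s
      using that k by (intro x_edge[of "Suc k"]) (auto simp: Z'_def m_def)
    show "inj_on (\<lambda>(t, s). pt s (fst t) (snd t)) (({..<m} \<times> Z') \<times> {..4 * m - 1})"
      by (auto simp: inj_on_def dest: pt_inj)
    show "door k i (fst t) \<le> 4 * m - 1" if "t \<in> {..<m} \<times> Z'" "i \<in> {..<q}" for t i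
      using that door_less[OF k, of i "fst t"] by (auto simp: m_def q_def)
    have "(4 * m - 1) * q \<le> (4 * m) * q" by simp
    also have "\<dots> \<le> m * (12 * m)" using qm by simp
    finally show "real (4 * m - 1) / card ({..<m} \<times> Z') \<le> r\<^sup>2"
      unfolding r using m by (intro ratio) (auto simp: Z'_def)
  qed (use m r in \<open>auto simp: Z'_def lessThan_empty_iff\<close>)

  \<comment> \<open>Fix \<open>x\<close> and \<open>z\<close>: from the width of room \<open>k\<close> to that of the next room in direction \<open>y\<close>.\<close>
  have 4: "\<bar>mean ({..<4 * m} \<times> Z') (\<lambda>t. mean {..<m} (\<lambda>y. f (pt (fst t) y (snd t))))
      - mean ({..<4 * m} \<times> Z') (\<lambda>t. mean {..<4 * m} (\<lambda>y. f (pt (fst t) y (snd t))))\<bar>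
      \<le> r * sqrt (energy G f)"
  proof (rule mean_lines_diff_le[OF nb f, where n = "4 * m - 1" and l = "\<lambda>t y. pt (fst t) y (snd t)"
        and a = "\<lambda>t y. y" and b = "\<lambda>t y. y"])
    show "{pt (fst t) s (snd t), pt (fst t) (Suc s) (snd t)} \<in> edges G"
      if "t \<in> {..<4 * m} \<times> Z'" "s < 4 * m - 1" for t s
      using that k by (intro y_edge[of "Suc k"]) (auto simp: Z'_def m_def)
    show "inj_on (\<lambda>(t, s). pt (fst t) s (snd t)) (({..<4 * m} \<times> Z') \<times> {..4 * m - 1})"
      by (auto simp: inj_on_def dest: pt_inj)
    have "(4 * m - 1) * q \<le> (4 * m) * q" by simp
    also have "\<dots> \<le> (4 * m) * (12 * m)" using qm by (intro mult_left_mono) auto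
    finally show "real (4 * m - 1) / card ({..<4 * m} \<times> Z') \<le> r\<^sup>2"
      unfolding r using m by (intro ratio) (auto simp: Z'_def)
  qed (use m r in \<open>auto simp: Z'_def lessThan_empty_iff\<close>)

  \<comment> \<open>Each step ends at the distribution at which the next one starts, with the coordinates grouped
    differently.\<close>
  have split: "mean (A \<times> B) h = mean A (\<lambda>a. mean B (\<lambda>b. h (a, b)))"
    for A B :: "nat set" and h
    using mean_Times[of A B "\<lambda>a b. h (a, b)"] by (simp add: case_prod_beta)
  have shift: "mean Z (\<lambda>z. f (pt x y (m + (z - m)))) = mean Z (\<lambda>z. f (pt x y z))"
    "mean Z' (\<lambda>z. f (pt x y (m + (z - m)))) = mean Z' (\<lambda>z. f (pt x y z))" for x y
    by (auto simp: mean_def Z_def Z'_def intro!: sum.cong)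

  have e0: "room_mean k f = mean ({..<m} \<times> Z) (\<lambda>t. mean {..<m} (\<lambda>x. f (pt x (fst t) (snd t))))"
    unfolding rm split fst_conv snd_conv
    by (subst mean_swap) (intro arg_cong[where f = "mean {..<m}"] ext mean_swap)
  have e1: "mean ({..<m} \<times> C) (\<lambda>t. mean {..<q} (\<lambda>i. f (pt (door k i (fst t)) (fst t) (snd t))))
      = mean ({..<q} \<times> {..<m}) (\<lambda>t. mean C (\<lambda>z. f (pt (door k (fst t) (snd t)) (snd t) z)))" for C
    unfolding split fst_conv snd_conv
    by (subst (2) mean_swap) (intro arg_cong[where f = "mean {..<m}"] ext mean_swap)
  have e3: "mean ({..<m} \<times> Z') (\<lambda>t. mean {..<4 * m} (\<lambda>x. f (pt x (fst t) (snd t))))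
      = mean ({..<4 * m} \<times> Z') (\<lambda>t. mean {..<m} (\<lambda>y. f (pt (fst t) y (snd t))))"
  proof -
    have "mean {..<m} (\<lambda>y. mean Z' (\<lambda>z. mean {..<4 * m} (\<lambda>x. f (pt x y z))))
      = mean Z' (\<lambda>z. mean {..<m} (\<lambda>y. mean {..<4 * m} (\<lambda>x. f (pt x y z))))" by (rule mean_swap)
    also have "\<dots> = mean Z' (\<lambda>z. mean {..<4 * m} (\<lambda>x. mean {..<m} (\<lambda>y. f (pt x y z))))"
      by (intro arg_cong[where f = "mean Z'"] ext mean_swap)
    also have "\<dots> = mean {..<4 * m} (\<lambda>x. mean Z' (\<lambda>z. mean {..<m} (\<lambda>y. f (pt x y z))))"
      by (rule mean_swap)
    finally show ?thesis unfolding split fst_conv snd_conv .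
  qed
  have e4: "room_mean (Suc k) f =
      mean ({..<4 * m} \<times> Z') (\<lambda>t. mean {..<4 * m} (\<lambda>y. f (pt (fst t) y (snd t))))"
    unfolding rm' split fst_conv snd_conv
    by (intro arg_cong[where f = "mean {..<4 * m}"] ext mean_swap)
  have "\<bar>room_mean k f - room_mean (Suc k) f\<bar> \<le> r * sqrt (energy G f) + 4 * r * sqrt (energy G f)
      + r * sqrt (energy G f) + r * sqrt (energy G f)"
    using 1 2 3 4 unfolding e0 e4 e1 e3 shift by linarith
  then show ?thesis
    unfolding r_def by (simp add: algebra_simps)
qed

text \<open>The steps form a geometric series, and the means vanish in the rooms that miss the support of \<open>f\<close>.\<close>

lemma room_mean_le:
  assumes f: "finite_support f"
  shows "\<bar>room_mean K f\<bar> \<le> 7 / (1 - sqrt (1/2)) * sqrt (energy G f)"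
proof -
  define r where "r = sqrt (1/2)"
  have r: "0 \<le> r" "r < 1" by (auto simp: r_def)
  have partial: "\<bar>room_mean K f - room_mean (K + n) f\<bar> \<le> 7 * (\<Sum>i<n. r ^ i) * sqrt (energy G f)" for n
  proof (induction n)
    case (Suc n)
    have "\<bar>room_mean (K + n) f - room_mean (Suc (K + n)) f\<bar> \<le> 7 * r ^ (K + n) * sqrt (energy G f)"
      using room_mean_step[OF f, of "K + n"] by (simp add: r_def real_sqrt_power)
    also have "\<dots> \<le> 7 * r ^ n * sqrt (energy G f)"
      using r by (intro mult_right_mono mult_left_mono power_decreasing) (auto simp: energy_nonneg)
    finally show ?case using Suc.IH by (simp add: algebra_simps)
  qed simp
  \<comment> \<open>As \<open>pt\<close> is injective, only finitely many heights meet the support of \<open>f\<close>.\<close>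
  obtain M where M: "f (pt x y z) = 0" if "M \<le> z" for x y z
  proof -
    have "finite {z. \<exists>x y. f (pt x y z) \<noteq> 0}"
    proof (rule finite_subset)
      show "{z. \<exists>x y. f (pt x y z) \<noteq> 0} \<subseteq> (\<lambda>v. THE z. \<exists>x y. v = pt x y z) ` {v. f v \<noteq> 0}"
      proof clarify
        fix x y z assume "f (pt x y z) \<noteq> 0"
        moreover have "(THE z'. \<exists>x' y'. pt x y z = pt x' y' z') = z"
          by (rule the_equality) (auto dest: pt_inj)
        ultimately show "z \<in> (\<lambda>v. THE z. \<exists>x y. v = pt x y z) ` {v. f v \<noteq> 0}"
          by (intro image_eqI[of _ _ "pt x y z"]) auto
      qed
    qed (use f in auto)
    then obtain M where "\<forall>z\<in>{z. \<exists>x y. f (pt x y z) \<noteq> 0}. z < M"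
      using finite_nat_set_iff_bounded by blast
    then show ?thesis using that by (metis (mono_tags, lifting) mem_Collect_eq not_less)
  qed
  have "room_mean (K + M) f = 0"
  proof -
    have "M \<le> 2 ^ M" by (rule less_imp_le[OF less_exp])
    also have "(2::nat) ^ M \<le> 4 ^ M" by (intro power_mono) auto
    also have "(4::nat) ^ M \<le> 4 ^ (K + M)" by (intro power_increasing) auto
    finally have "M \<le> 4 ^ (K + M)" .
    then have "mean {4 ^ (K + M)..<4 ^ Suc (K + M)} (\<lambda>z. f (pt x y z)) = 0" for x y
      unfolding mean_def using M by (subst sum.neutral) auto
    then show ?thesis by (simp add: room_mean_def) (simp add: mean_def)
  qed
  then have "\<bar>room_mean K f\<bar> \<le> 7 * (\<Sum>i<M. r ^ i) * sqrt (energy G f)"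
    using partial[of M] by simp
  also have "\<dots> \<le> 7 * (1 / (1 - r)) * sqrt (energy G f)"
    using r by (intro mult_right_mono mult_left_mono)
      (auto simp: energy_nonneg sum_gp_strict divide_right_mono)
  finally show ?thesis by (simp add: r_def)
qed

end

text \<open>The mean over room \<open>K\<close> is controlled by the energy, and it differs from the value at a single
  vertex of this finite room by a multiple of the root of the energy.\<close>

theorem transient_rooms_with_doors:
  fixes G :: "'v :: countable ugraph"
  assumes "rooms_with_doors G pt K door" and conn: "connected_graph G"
    and room: "\<And>x y z. x < 4 ^ K \<Longrightarrow> y < 4 ^ K \<Longrightarrow> z \<in> {4 ^ K..<4 ^ Suc K} \<Longrightarrow> pt x y z \<in> verts G"
  shows "transient G"
proof -
  interpret rooms_with_doors G pt K door by fact
  let ?o = "pt 0 0 (4 ^ K)"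
  let ?R = "{..<4 ^ K} \<times> {..<4 ^ K} \<times> {4 ^ K..<4 ^ Suc K}"
  have o: "?o \<in> verts G" using room by simp
  have "\<exists>C\<ge>0. \<forall>f. finite_support f \<longrightarrow> \<bar>f ?o - f (pt x y z)\<bar> \<le> C * sqrt (energy G f)"
    if "(x, y, z) \<in> ?R" for x y z
    by (rule reachable_diff_le[OF nb]) (use conn o room that in \<open>auto simp: connected_graph_def\<close>)
  then have "\<forall>p\<in>?R. \<exists>C\<ge>0. \<forall>f. finite_support f \<longrightarrow>
      \<bar>f ?o - f (pt (fst p) (fst (snd p)) (snd (snd p)))\<bar> \<le> C * sqrt (energy G f)"
    by auto
  then obtain D where D: "\<And>p. p \<in> ?R \<Longrightarrow> D p \<ge> 0" "\<And>p f. p \<in> ?R \<Longrightarrow> finite_support f \<Longrightarrow>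
      \<bar>f ?o - f (pt (fst p) (fst (snd p)) (snd (snd p)))\<bar> \<le> D p * sqrt (energy G f)"
    by metis
  define B where "B = (\<Sum>p\<in>?R. D p)"
  have B: "B \<ge> 0" unfolding B_def by (rule sum_nonneg) (rule D)
  have DB: "D p \<le> B" if "p \<in> ?R" for p
    unfolding B_def by (rule member_le_sum) (use that D(1) in auto)
  define C where "C = B + 7 / (1 - sqrt (1/2))"
  show ?thesis
  proof (rule transient_of_energy_bound[OF nb conn o])
    show "C \<ge> 0" using B by (simp add: C_def)
    fix f :: "'v \<Rightarrow> real" assume f: "finite_support f"
    have close: "\<bar>f ?o - f (pt x y z)\<bar> \<le> B * sqrt (energy G f)"
      if "x < 4 ^ K" "y < 4 ^ K" "z \<in> {4 ^ K..<4 ^ Suc K}" for x y z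
    proof -
      have p: "(x, y, z) \<in> ?R" using that by simp
      have "\<bar>f ?o - f (pt x y z)\<bar> \<le> D (x, y, z) * sqrt (energy G f)"
        using D(2)[OF p f] by simp
      also have "\<dots> \<le> B * sqrt (energy G f)"
        by (intro mult_right_mono DB p) (simp add: energy_nonneg)
      finally show ?thesis .
    qed
    have "f ?o - B * sqrt (energy G f) \<le> room_mean K f"
      unfolding room_mean_def
      by (intro mean_ge) (use close in \<open>auto simp: lessThan_empty_iff abs_le_iff\<close>, smt (verit) close atLeastLessThan_iff)
    moreover have "room_mean K f \<le> f ?o + B * sqrt (energy G f)"
      unfolding room_mean_def
      by (intro mean_le) (use close in \<open>auto simp: lessThan_empty_iff abs_le_iff\<close>, smt (verit) close atLeastLessThan_iff)
    ultimately show "\<bar>f ?o\<bar> \<le> C * sqrt (energy G f)"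
      using room_mean_le[OF f] unfolding C_def distrib_right by linarith
  qed
qed

section \<open>The chain of rooms with single doors\<close>

text \<open>The index of the room at height \<open>z\<close>, that is, the integer part of the logarithm of \<open>z\<close> to base 4
  for \<open>z > 0\<close>.\<close>

definition room :: "nat \<Rightarrow> nat" where
  "room z = (LEAST k. z < 4 ^ Suc k)"

lemma room_eqI:
  assumes "4 ^ k \<le> z" "z < 4 ^ Suc k"
  shows "room z = k"
  unfolding room_def
proof (rule Least_equality)
  fix l assume "z < 4 ^ Suc l"
  then have "(4::nat) ^ k < 4 ^ Suc l" using assms(1) by linarith
  then show "k \<le> l" by (simp only: power_strict_increasing_iff less_Suc_eq_le)
qed (rule assms)

lemma less_power_room: "z < 4 ^ Suc (room z)"
  unfolding room_def
proof (rule LeastI)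
  have "z < 2 ^ z" by (rule less_exp)
  also have "(2::nat) ^ z \<le> 4 ^ z" by (intro power_mono) auto
  also have "(4::nat) ^ z \<le> 4 ^ Suc z" by (intro power_increasing) auto
  finally show "z < 4 ^ Suc z" .
qed

lemma power_room_le:
  assumes "z > 0"
  shows "4 ^ room z \<le> z"
proof (cases "room z")
  case (Suc k)
  then have "\<not> z < 4 ^ Suc k"
    using not_less_Least[of k "\<lambda>k. z < 4 ^ Suc k"] by (simp add: room_def)
  then show ?thesis by (simp add: Suc)
qed (use assms in auto)

lemma room_mono: "z \<le> z' \<Longrightarrow> room z \<le> room z'"
  unfolding room_def[of z] by (rule Least_le) (use less_power_room[of z'] in linarith)

lemma room_Suc:
  assumes "z > 0" "room (Suc z) \<noteq> room z"
  shows "Suc z = 4 ^ Suc (room z)"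
proof (rule ccontr)
  assume "Suc z \<noteq> 4 ^ Suc (room z)"
  then have "Suc z < 4 ^ Suc (room z)"
    using less_power_room[of z] by linarith
  moreover have "4 ^ room z \<le> Suc z" using power_room_le[OF assms(1)] by linarith
  ultimately show False using room_eqI assms(2) by blast
qed

text \<open>Coordinates for the part of a graph that carries the rooms.\<close>

locale grid =
  fixes pt :: "nat \<Rightarrow> nat \<Rightarrow> nat \<Rightarrow> 'v :: countable"
  assumes pt_inj: "\<And>x y z x' y' z'. pt x y z = pt x' y' z' \<Longrightarrow> x = x' \<and> y = y' \<and> z = z'"
begin

definition in_room :: "nat \<Rightarrow> nat \<Rightarrow> nat \<Rightarrow> bool" where
  "in_room x y z \<longleftrightarrow> z > 0 \<and> x < 4 ^ room z \<and> y < 4 ^ room z"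

text \<open>The edges in directions \<open>x\<close> and \<open>y\<close> never leave a room. An edge in direction \<open>z\<close> between two
  different rooms is kept on the axis \<open>x = y = 0\<close> only.\<close>

definition chain :: "'v ugraph" where
  "chain = \<lparr>verts = {pt x y z | x y z. in_room x y z},
    edges = {{pt x y z, pt (Suc x) y z} | x y z. in_room (Suc x) y z} \<union>
      {{pt x y z, pt x (Suc y) z} | x y z. in_room x (Suc y) z} \<union>
      {{pt x y z, pt x y (Suc z)} | x y z. in_room x y z \<and>
        (room (Suc z) = room z \<or> x = 0 \<and> y = 0)}\<rparr>"

lemma pt_eq_iff [simp]: "pt x y z = pt x' y' z' \<longleftrightarrow> x = x' \<and> y = y' \<and> z = z'"
  using pt_inj by blast

lemma in_room_Suc:
  "in_room (Suc x) y z \<Longrightarrow> in_room x y z" "in_room x (Suc y) z \<Longrightarrow> in_room x y z"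
  "in_room x y z \<Longrightarrow> in_room x y (Suc z)"
proof -
  have le: "(4::nat) ^ room z \<le> 4 ^ room (Suc z)"
    by (intro power_increasing room_mono) auto
  show "in_room x y z \<Longrightarrow> in_room x y (Suc z)"
    by (auto simp: in_room_def intro: order.strict_trans2[OF _ le])
qed (auto simp: in_room_def)

lemma edges_chainI:
  "in_room (Suc x) y z \<Longrightarrow> {pt x y z, pt (Suc x) y z} \<in> edges chain"
  "in_room x (Suc y) z \<Longrightarrow> {pt x y z, pt x (Suc y) z} \<in> edges chain"
  "in_room x y z \<Longrightarrow> room (Suc z) = room z \<or> x = 0 \<and> y = 0 \<Longrightarrow>
    {pt x y z, pt x y (Suc z)} \<in> edges chain"
  unfolding chain_def by (simp_all only: ugraph.select_convs) blast+

lemma edges_chainE: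
  assumes "e \<in> edges chain"
  obtains x y z where "e = {pt x y z, pt (Suc x) y z}" "in_room (Suc x) y z"
    | x y z where "e = {pt x y z, pt x (Suc y) z}" "in_room x (Suc y) z"
    | x y z where "e = {pt x y z, pt x y (Suc z)}" "in_room x y z"
        "room (Suc z) = room z \<or> x = 0 \<and> y = 0"
  using assms unfolding chain_def ugraph.select_convs
  by (elim UnE CollectE exE conjE) (rule that, assumption+)+

lemma simple_graph_chain: "simple_graph chain"
  unfolding simple_graph_def
proof
  fix e assume "e \<in> edges chain"
  then show "e \<subseteq> verts chain \<and> card e = 2"
    by (auto simp: chain_def intro: in_room_Suc)
qed

lemma locally_finite_chain: "locally_finite chain"
  unfolding locally_finite_def
proof
  fix v assume "v \<in> verts chain"
  then obtain x y z where v: "v = pt x y z" by (auto simp: chain_def)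
  have "neighbours chain v \<subseteq> {pt (Suc x) y z, pt (x - 1) y z, pt x (Suc y) z, pt x (y - 1) z, pt x y (Suc z), pt x y (z - 1)}"
    by (auto simp: neighbours_def chain_def v doubleton_eq_iff)
  then show "finite (neighbours chain v)" by (rule finite_subset) auto
qed

lemma connected_chain: "connected_graph chain"
proof -
  have x: "reachable chain (pt x y z) (pt 0 y z)" if "in_room x y z" for x y z
    using that
  proof (induction x)
    case (Suc x)
    then have "{pt (Suc x) y z, pt x y z} \<in> edges chain"
      by (simp add: edges_chainI insert_commute)
    then show ?case
      using Suc in_room_Suc(1) reachable_edge reachable_trans by metis
  qed (simp add: reachable_def)
  have y: "reachable chain (pt 0 y z) (pt 0 0 z)" if "in_room 0 y z" for y z
    using that
  proof (induction y)
    case (Suc y)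
    then have "{pt 0 (Suc y) z, pt 0 y z} \<in> edges chain"
      by (simp add: edges_chainI insert_commute)
    then show ?case
      using Suc in_room_Suc(2) reachable_edge reachable_trans by metis
  qed (simp add: reachable_def)
  have z: "reachable chain (pt 0 0 (Suc z)) (pt 0 0 1)" for z
  proof (induction z)
    case (Suc z)
    have "{pt 0 0 (Suc z), pt 0 0 (Suc (Suc z))} \<in> edges chain"
      by (intro edges_chainI) (auto simp: in_room_def)
    then have "{pt 0 0 (Suc (Suc z)), pt 0 0 (Suc z)} \<in> edges chain"
      by (simp add: insert_commute)
    then show ?case
      using Suc reachable_edge reachable_trans by metis
  qed (simp add: reachable_def)
  have "reachable chain v (pt 0 0 1)" if "v \<in> verts chain" for v
  proof -
    obtain x y z where v: "v = pt x y z" and r: "in_room x y z"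
      using \<open>v \<in> verts chain\<close> by (auto simp: chain_def)
    have "in_room 0 y z" "z = Suc (z - 1)" using r by (auto simp: in_room_def)
    then show ?thesis
      unfolding v using x[OF r] y z[of "z - 1"] reachable_trans by metis
  qed
  moreover have "pt 0 0 1 \<in> verts chain"
    by (force simp: chain_def in_room_def)
  ultimately show ?thesis
    unfolding connected_graph_def using reachable_sym reachable_trans by (metis empty_iff)
qed

text \<open>Constant on each room, decreasing linearly in the index of the room from 1 to 0. The coordinates of
  a vertex, and thus its room, are unique because \<open>pt\<close> is injective.\<close>

definition cutoff :: "nat \<Rightarrow> 'v \<Rightarrow> real" where
  "cutoff n v = (if v \<in> verts chain then max 0 (1 - real (THE k. \<exists>x y z. v = pt x y z \<and> k = room z) / n) else 0)"

lemma cutoff_pt: "in_room x y z \<Longrightarrow> cutoff n (pt x y z) = max 0 (1 - real (room z) / n)"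
  by (auto simp: cutoff_def chain_def)

lemma finite_support_cutoff:
  assumes "n > 0"
  shows "finite_support (cutoff n)"
proof (rule finite_subset)
  show "{v. cutoff n v \<noteq> 0} \<subseteq> (\<lambda>(x, y, z). pt x y z) ` ({..<4 ^ n} \<times> {..<4 ^ n} \<times> {..<4 ^ n})"
  proof
    fix v assume v: "v \<in> {v. cutoff n v \<noteq> 0}"
    then have "v \<in> verts chain" by (cases "v \<in> verts chain") (auto simp: cutoff_def)
    then obtain x y z where xyz: "v = pt x y z" "in_room x y z" by (auto simp: chain_def)
    have "room z < n"
    proof (rule ccontr)
      assume "\<not> room z < n"
      then have "real (room z) / n \<ge> 1" using assms by simp
      then show False using v xyz by (simp add: cutoff_pt)
    qed
    then have "(4::nat) ^ Suc (room z) \<le> 4 ^ n" by (intro power_increasing) auto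
    moreover have "x < 4 ^ Suc (room z)" "y < 4 ^ Suc (room z)"
      using xyz(2) by (auto simp: in_room_def)
    ultimately have "x < 4 ^ n" "y < 4 ^ n" "z < 4 ^ n"
      using less_power_room[of z] by linarith+
    then show "v \<in> (\<lambda>(x, y, z). pt x y z) ` ({..<4 ^ n} \<times> {..<4 ^ n} \<times> {..<4 ^ n})"
      unfolding xyz(1) by (intro image_eqI[of _ _ "(x, y, z)"]) auto
  qed
qed auto

text \<open>The function changes only across the \<open>n\<close> edges that join the first \<open>n + 1\<close> rooms, by \<open>1 / n\<close> across each
  of them, and each edge counts twice.\<close>

lemma energy_cutoff_le:
  assumes "n > 0"
  shows "energy chain (cutoff n) \<le> 2 / n"
proof -
  let ?D = "{(u, v). {u, v} \<in> edges chain \<and> cutoff n u \<noteq> cutoff n v}"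
  define door where "door = (\<lambda>k. (pt 0 0 (4 ^ Suc k - 1), pt 0 0 (4 ^ Suc k)))"
  let ?A = "door ` {..<n} \<union> prod.swap ` door ` {..<n}"
  have rooms: "room (4 ^ Suc k - 1) = k" "room (4 ^ Suc k) = Suc k" for k
  proof -
    have "(4::nat) ^ k \<ge> 1" by simp
    then have "4 ^ k \<le> 4 ^ Suc k - (1::nat)" by (simp only: power_Suc)
    then show "room (4 ^ Suc k - 1) = k"
      by (intro room_eqI) auto
    show "room (4 ^ Suc k) = Suc k" by (intro room_eqI) auto
  qed
  have cut: "cutoff n (fst (door k)) = max 0 (1 - real k / n)"
      "cutoff n (snd (door k)) = max 0 (1 - real (Suc k) / n)" for k
  proof -
    have "(1::nat) < 4 ^ Suc k" by (rule one_less_power) auto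
    then have "in_room 0 0 (4 ^ Suc k - 1)" "in_room 0 0 (4 ^ Suc k)"
      by (auto simp: in_room_def)
    then show "cutoff n (fst (door k)) = max 0 (1 - real k / n)"
      "cutoff n (snd (door k)) = max 0 (1 - real (Suc k) / n)"
      unfolding door_def fst_conv snd_conv by (simp_all only: cutoff_pt rooms)
  qed
  have diff: "(cutoff n (fst p) - cutoff n (snd p))\<^sup>2 \<le> 1 / (real n)\<^sup>2" if p: "p \<in> ?A" for p
  proof -
    have "\<bar>max 0 (1 - a) - max 0 (1 - (b + a))\<bar> \<le> b" if "b \<ge> 0" for a b :: real
      using that by (auto simp: max_def)
    from this[of "1 / n" "real k / n" for k]
    have "\<bar>max 0 (1 - real k / n) - max 0 (1 - real (Suc k) / n)\<bar> \<le> 1 / n" for k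
      by (simp add: add_divide_distrib)
    then have sq: "(max 0 (1 - real k / n) - max 0 (1 - real (Suc k) / n))\<^sup>2 \<le> (1 / n)\<^sup>2" for k
      using abs_le_square_iff by fastforce
    have "(cutoff n (fst (door k)) - cutoff n (snd (door k)))\<^sup>2 \<le> 1 / (real n)\<^sup>2" for k
      unfolding cut using sq[of k] by (simp only: power_divide power_one)
    moreover obtain k where "p = door k \<or> p = prod.swap (door k)"
      using p by blast
    ultimately show ?thesis
      by (elim disjE) (simp_all add: power2_commute[of "cutoff n (snd (door k))"])
  qed
  have sub: "?D \<subseteq> ?A"
  proof clarify
    fix u v assume uv: "{u, v} \<in> edges chain" "cutoff n u \<noteq> cutoff n v" "(u, v) \<notin> prod.swap ` door ` {..<n}"
    have up: "(u, v) \<in> door ` {..<n}"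
      if uv: "cutoff n u \<noteq> cutoff n v" and z: "u = pt x y z" "v = pt x y (Suc z)" "in_room x y z"
        "room (Suc z) = room z \<or> x = 0 \<and> y = 0" for u v x y z
    proof -
      have cu: "cutoff n u = max 0 (1 - real (room z) / n)" "cutoff n v = max 0 (1 - real (room (Suc z)) / n)"
        using z in_room_Suc(3) by (auto simp: cutoff_pt)
      then have ne: "room (Suc z) \<noteq> room z" using uv by auto
      have z0: "z > 0" using z by (auto simp: in_room_def)
      have eq: "Suc z = 4 ^ Suc (room z)" by (rule room_Suc[OF z0 ne])
      have "room z < n"
      proof (rule ccontr)
        assume "\<not> room z < n"
        then have "real (room z) / n \<ge> 1" "real (room (Suc z)) / n \<ge> 1"
          using assms room_mono[of z "Suc z"] by auto
        then show False using uv cu by auto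
      qed
      moreover have "(u, v) = door (room z)"
        using z ne eq by (auto simp: door_def simp del: power_Suc)
      ultimately show ?thesis by blast
    qed
    have "(u, v) \<in> door ` {..<n} \<or> (v, u) \<in> door ` {..<n}"
    proof -
      have flat_x: "cutoff n (pt (Suc x) y z) = cutoff n (pt x y z)" if "in_room (Suc x) y z" for x y z
        using that in_room_Suc(1)[OF that] by (simp add: cutoff_pt)
      have flat_y: "cutoff n (pt x (Suc y) z) = cutoff n (pt x y z)" if "in_room x (Suc y) z" for x y z
        using that in_room_Suc(2)[OF that] by (simp add: cutoff_pt)
      obtain x y z where "{u, v} = {pt x y z, pt x y (Suc z)}" "in_room x y z"
          "room (Suc z) = room z \<or> x = 0 \<and> y = 0"
        using uv(1)
      proof (cases rule: edges_chainE)
        case (1 x y z)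
        with flat_x[OF 1(2)] uv(2) show thesis by (auto simp only: doubleton_eq_iff)
      next
        case (2 x y z)
        with flat_y[OF 2(2)] uv(2) show thesis by (auto simp only: doubleton_eq_iff)
      qed (rule that)
      then show ?thesis
        using up[of u v x y z] up[of v u x y z] uv(2) by (metis doubleton_eq_iff)
    qed
    then show "(u, v) \<in> door ` {..<n}"
      using uv(3) by (metis image_eqI swap_simp)
  qed
  have "energy chain (cutoff n) = (\<Sum>p\<in>?D. (cutoff n (fst p) - cutoff n (snd p))\<^sup>2)"
    unfolding energy_def by (rule sum.cong) auto
  also have "\<dots> \<le> (\<Sum>p\<in>?A. (cutoff n (fst p) - cutoff n (snd p))\<^sup>2)"
    by (rule sum_mono2[OF _ sub]) auto
  also have "\<dots> \<le> card ?A * (1 / (real n)\<^sup>2)"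
    by (rule sum_bounded_above) (rule diff)
  also have "\<dots> \<le> (2 * n) * (1 / (real n)\<^sup>2)"
  proof (rule mult_right_mono)
    have "card ?A \<le> card (door ` {..<n}) + card (prod.swap ` door ` {..<n})" by (rule card_Un_le)
    also have "\<dots> \<le> n + n"
      by (intro add_mono order.trans[OF card_image_le] ) (auto intro: order.trans[OF card_image_le])
    finally show "real (card ?A) \<le> 2 * n" by linarith
  qed auto
  also have "\<dots> = 2 / n" using assms by (simp add: power2_eq_square)
  finally show ?thesis .
qed

theorem recurrent_chain: "recurrent chain"
  unfolding recurrent_def
proof (intro conjI ballI connected_chain)
  fix v assume "v \<in> verts chain"
  then obtain x y z where v: "v = pt x y z" "in_room x y z" by (auto simp: chain_def)
  show "return_prob chain v = 1"
  proof (rule return_prob_eq_1_of_energy_tendsto_0)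
    show "finite (neighbours chain w)" for w
      by (rule finite_neighbours[OF simple_graph_chain locally_finite_chain])
    show "finite_support (cutoff (Suc m))" for m by (rule finite_support_cutoff) simp
    have "(\<lambda>m. real (room z) / real (Suc m)) \<longlonglongrightarrow> 0"
      using LIMSEQ_Suc[OF lim_const_over_n] .
    then have "(\<lambda>m. max 0 (1 - real (room z) / real (Suc m))) \<longlonglongrightarrow> max 0 (1 - 0)"
      by (intro tendsto_intros)
    then show "(\<lambda>m. cutoff (Suc m) v) \<longlonglongrightarrow> 1"
      by (simp add: v cutoff_pt)
    show "(\<lambda>m. energy chain (cutoff (Suc m))) \<longlonglongrightarrow> 0"
    proof (rule tendsto_sandwich[where f = "\<lambda>_. 0" and h = "\<lambda>m. 2 / real (Suc m)"])
      show "(\<lambda>m. 2 / real (Suc m)) \<longlonglongrightarrow> 0"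
        using LIMSEQ_Suc[OF lim_const_over_n] .
      show "\<forall>\<^sub>F m in sequentially. energy chain (cutoff (Suc m)) \<le> 2 / real (Suc m)"
        by (intro always_eventually allI energy_cutoff_le) simp
    qed (auto intro!: always_eventually energy_nonneg)
  qed
qed

end

section \<open>Enlargements\<close>

lemma open_edge_in_enlargement:
  assumes "{a, b} \<in> edges G" "\<omega> {a, b}" "a \<in> verts H"
  shows "{a, b} \<in> edges (enlargement G H \<omega>)"
proof -
  have "{a, b} \<in> edges (open_subgraph G \<omega>)"
    using assms by (simp add: open_subgraph_def)
  then have "{a, b} \<in> edges (open_cluster G \<omega> a)"
    by (auto simp: open_cluster_def Let_def reachable_def)
  then show ?thesis
    using assms(3) by (auto simp: enlargement_def)
qed

lemma enlargement_supergraph: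
  "verts H \<subseteq> verts (enlargement G H \<omega>)" "edges H \<subseteq> edges (enlargement G H \<omega>)"
  by (auto simp: enlargement_def open_cluster_def Let_def reachable_def)

lemma connected_enlargement:
  assumes "connected_graph H"
  shows "connected_graph (enlargement G H \<omega>)"
proof -
  let ?U = "enlargement G H \<omega>"
  have to_H: "\<exists>x\<in>verts H. reachable ?U x v" if v: "v \<in> verts ?U" for v
  proof -
    obtain x where x: "x \<in> verts H" and xv: "reachable (open_subgraph G \<omega>) x v"
      using v by (auto simp: enlargement_def open_cluster_def Let_def)
    have "reachable (open_subgraph G \<omega>) x v \<and> reachable ?U x v"
      using xv unfolding reachable_def
    proof (induction rule: rtranclp_induct)
      case (step y z)
      then have "reachable (open_subgraph G \<omega>) x z"
        unfolding reachable_def by (blast intro: rtranclp.rtrancl_into_rtrancl)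
      with step have "{y, z} \<in> edges (open_cluster G \<omega> x)"
        by (simp add: open_cluster_def Let_def reachable_def)
      then have "{y, z} \<in> edges ?U"
        using x by (auto simp: enlargement_def)
      with step show ?case by (blast intro: rtranclp.rtrancl_into_rtrancl)
    qed simp
    with x show ?thesis by blast
  qed
  show ?thesis
    unfolding connected_graph_def
  proof (intro conjI ballI)
    show "verts ?U \<noteq> {}"
      using assms enlargement_supergraph(1) by (fastforce simp: connected_graph_def)
  next
    fix u v assume "u \<in> verts ?U" "v \<in> verts ?U"
    then obtain x y where "x \<in> verts H" "y \<in> verts H" "reachable ?U x u" "reachable ?U y v"
      using to_H by blast
    moreover from this have "reachable H x y"
      using assms by (simp add: connected_graph_def)
    then have "reachable ?U x y"
      by (rule reachable_mono[OF enlargement_supergraph(2)])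
    ultimately show "reachable ?U u v"
      using reachable_sym reachable_trans by metis
  qed
qed

section \<open>Open edges in large blocks\<close>

lemma percolation_all_closed:
  assumes p: "0 \<le> p" "p \<le> 1" and B: "finite B" "B \<subseteq> edges G"
  shows "{\<omega> \<in> space (percolation G p). \<forall>e\<in>B. \<not> \<omega> e} \<in> sets (percolation G p)"
    and "measure (percolation G p) {\<omega> \<in> space (percolation G p). \<forall>e\<in>B. \<not> \<omega> e} = (1 - p) ^ card B"
proof -
  define M where "M = (\<lambda>_ :: 'a set. measure_pmf (bernoulli_pmf p))"
  interpret product_prob_space M "edges G"
    by (rule product_prob_spaceI) (auto simp: M_def measure_pmf.prob_space_axioms)
  define F where "F = (\<lambda>_ :: 'a set. {False})"
  have eq: "{\<omega> \<in> space (percolation G p). \<forall>e\<in>B. \<not> \<omega> e} = prod_emb (edges G) M B (Pi\<^sub>E B F)"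
    using B by (auto simp: percolation_def prod_emb_def space_PiM M_def restrict_PiE_iff)
      (auto simp: F_def)
  show "{\<omega> \<in> space (percolation G p). \<forall>e\<in>B. \<not> \<omega> e} \<in> sets (percolation G p)"
    unfolding eq unfolding percolation_def M_def[symmetric]
    using B by (intro sets_PiM_I) (auto simp: M_def)
  have "measure (Pi\<^sub>M (edges G) M) (prod_emb (edges G) M B (Pi\<^sub>E B F)) =
      (\<Prod>e\<in>B. measure (M e) (F e))"
    using B by (intro measure_PiM_emb) (auto simp: M_def)
  then show "measure (percolation G p) {\<omega> \<in> space (percolation G p). \<forall>e\<in>B. \<not> \<omega> e} = (1 - p) ^ card B"
    unfolding eq unfolding percolation_def M_def[symmetric]
    using p by (simp add: M_def F_def measure_pmf_single)
qed

text \<open>Consecutive terms have ratio \<open>8 * q ^ (2 ^ k)\<close>, which tends to 0.\<close>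

lemma summable_8_power_mult_power_2_power:
  fixes q :: real
  assumes "0 \<le> q" "q < 1"
  shows "summable (\<lambda>k. 8 ^ k * q ^ (2 ^ k))"
proof -
  have "(\<lambda>k. q ^ k) \<longlonglongrightarrow> 0" using assms by (intro LIMSEQ_power_zero) auto
  then have "\<forall>\<^sub>F k in sequentially. q ^ k < 1 / 16" by (rule order_tendstoD) simp
  then obtain N where N: "q ^ k < 1 / 16" if "N \<le> k" for k
    by (auto simp: eventually_sequentially)
  show ?thesis
  proof (rule summable_ratio_test[where c = "1/2" and N = N])
    fix k assume "N \<le> k"
    have "q ^ (2 ^ k) \<le> q ^ k"
      using assms less_exp[of k] by (intro power_decreasing) auto
    then have "8 * q ^ (2 ^ k) \<le> 1 / 2" using N[OF \<open>N \<le> k\<close>] by linarith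
    then have "(8 * q ^ (2 ^ k)) * (8 ^ k * q ^ (2 ^ k)) \<le> 1 / 2 * (8 ^ k * q ^ (2 ^ k))"
      using assms by (intro mult_right_mono) auto
    moreover have "8 ^ Suc k * q ^ (2 ^ Suc k) = (8 * q ^ (2 ^ k)) * (8 ^ k * q ^ (2 ^ k))"
      by (simp add: mult_2 power_add)
    ultimately show "norm (8 ^ Suc k * q ^ (2 ^ Suc k)) \<le> 1 / 2 * norm (8 ^ k * q ^ (2 ^ k))"
      using assms by (simp only:) (simp add: abs_mult)
  qed simp
qed

text \<open>A block of \<open>2 ^ k\<close> edges is closed with probability \<open>(1 - p) ^ (2 ^ k)\<close>. This is so small that the sum
  over all \<open>k\<close> and all of the at most \<open>8 ^ k\<close> blocks converges, and the first Borel-Cantelli lemma applies.\<close>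

lemma AE_eventually_all_blocks_open:
  fixes G :: "'a ugraph" and B :: "nat \<Rightarrow> 't \<Rightarrow> 'a set set"
  assumes p: "0 < p" "p \<le> 1"
    and I: "\<And>k. finite (I k)" "\<And>k. card (I k) \<le> 8 ^ k"
    and B: "\<And>k t. t \<in> I k \<Longrightarrow> B k t \<subseteq> edges G" "\<And>k t. t \<in> I k \<Longrightarrow> card (B k t) = 2 ^ k"
  shows "AE \<omega> in percolation G p. \<forall>\<^sub>F k in sequentially. \<forall>t\<in>I k. \<exists>e\<in>B k t. \<omega> e"
proof -
  let ?M = "percolation G p"
  interpret prob_space ?M
    unfolding percolation_def by (rule prob_space_PiM) (rule measure_pmf.prob_space_axioms)
  define C where "C = (\<lambda>k t. {\<omega> \<in> space ?M. \<forall>e\<in>B k t. \<not> \<omega> e})"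
  have fin: "finite (B k t)" if "t \<in> I k" for k t
    using B(2)[OF that] by (metis card.infinite power_not_zero zero_neq_numeral)
  have C: "C k t \<in> events" "prob (C k t) = (1 - p) ^ (2 ^ k)" if "t \<in> I k" for k t
    using percolation_all_closed[OF _ p(2) fin[OF that] B(1)[OF that]] p(1) B(2)[OF that]
    by (auto simp: C_def)
  have "AE \<omega> in ?M. \<forall>\<^sub>F k in sequentially. \<omega> \<in> space ?M - (\<Union>t\<in>I k. C k t)"
  proof (rule borel_cantelli_AE1)
    show "(\<Union>t\<in>I k. C k t) \<in> events" for k
      using C(1) I(1) by blast
    show "emeasure ?M (\<Union>t\<in>I k. C k t) < \<infinity>" for k
      by (simp add: emeasure_eq_measure)
    show "summable (\<lambda>k. prob (\<Union>t\<in>I k. C k t))"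
    proof (rule summable_comparison_test'[OF summable_8_power_mult_power_2_power])
      show "norm (prob (\<Union>t\<in>I k. C k t)) \<le> 8 ^ k * (1 - p) ^ (2 ^ k)" if "k \<ge> 0" for k
      proof -
        have "prob (\<Union>t\<in>I k. C k t) \<le> (\<Sum>t\<in>I k. prob (C k t))"
          using C(1) I(1) by (intro finite_measure_subadditive_finite) auto
        also have "\<dots> = card (I k) * (1 - p) ^ (2 ^ k)"
          using C(2) by simp
        also have "\<dots> \<le> 8 ^ k * (1 - p) ^ (2 ^ k)"
        proof (rule mult_right_mono)
          show "real (card (I k)) \<le> 8 ^ k"
            using I(2)[of k] by (metis of_nat_le_iff of_nat_numeral of_nat_power)
        qed (use p in simp)
        finally show ?thesis by simp
      qed
    qed (use p in auto)
  qed
  then show ?thesis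
  proof (rule AE_mp, intro AE_I2 impI)
    fix \<omega> assume "\<forall>\<^sub>F k in sequentially. \<omega> \<in> space ?M - (\<Union>t\<in>I k. C k t)"
    then show "\<forall>\<^sub>F k in sequentially. \<forall>t\<in>I k. \<exists>e\<in>B k t. \<omega> e"
      by (rule eventually_mono) (auto simp: C_def)
  qed
qed

section \<open>Transience of the enlarged chain\<close>

text \<open>Both ends of every edge of a wall are vertices of \<open>chain\<close>, so each open edge of a wall belongs to the
  enlargement. Almost surely these edges provide a door in every block of all but finitely many walls.\<close>

theorem (in grid) AE_transient_enlargement_chain:
  assumes G: "simple_graph G" "locally_finite G" "subgraph chain G"
    and z_edge: "\<And>x y z. {pt x y z, pt x y (Suc z)} \<in> edges G"
    and p: "0 < p" "p \<le> 1"
  shows "AE \<omega> in percolation G p. transient (enlargement G chain \<omega>)"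
proof -
  define e where "e = (\<lambda>k x y. {pt x y (4 ^ Suc k - 1), pt x y (4 ^ Suc k)})"
  define B where "B = (\<lambda>k t. (\<lambda>s. e k (fst t * 2 ^ k + s) (snd t)) ` {..<2 ^ k})"
  have e_edge: "e k x y \<in> edges G" for k x y
  proof -
    have "(4::nat) ^ Suc k > 0" by simp
    then show ?thesis
      using z_edge[of x y "4 ^ Suc k - 1"] by (simp only: e_def Suc_pred' diff_Suc_1 Suc_diff_1)
  qed
  have "AE \<omega> in percolation G p. \<forall>\<^sub>F k in sequentially. \<forall>t\<in>{..<2 ^ k} \<times> {..<4 ^ k}. \<exists>f\<in>B k t. \<omega> f"
  proof (rule AE_eventually_all_blocks_open[OF p])
    show "card ({..<2 ^ k} \<times> {..<4 ^ k} :: (nat \<times> nat) set) \<le> 8 ^ k" for k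
      by (simp add: card_cartesian_product power_mult_distrib[symmetric])
    show "B k t \<subseteq> edges G" for k t using e_edge by (auto simp: B_def)
    show "card (B k t) = 2 ^ k" for k t
      unfolding B_def by (subst card_image) (auto simp: inj_on_def e_def doubleton_eq_iff)
  qed auto
  then show ?thesis
  proof (rule AE_mp, intro AE_I2 impI)
    fix \<omega>
    let ?U = "enlargement G chain \<omega>"
    assume "\<forall>\<^sub>F k in sequentially. \<forall>t\<in>{..<2 ^ k} \<times> {..<4 ^ k}. \<exists>f\<in>B k t. \<omega> f"
    then obtain K where K: "\<exists>f\<in>B k (i, j). \<omega> f" if "K \<le> k" "i < 2 ^ k" "j < 4 ^ k" for k i j
      by (fastforce simp: eventually_sequentially)
    have "\<exists>d. i * 2 ^ k \<le> d \<and> d < Suc i * 2 ^ k \<and> \<omega> (e k d j)"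
      if kij: "K \<le> k" "i < 2 ^ k" "j < 4 ^ k" for k i j
    proof -
      obtain s where "s < 2 ^ k" "\<omega> (e k (i * 2 ^ k + s) j)"
        using K[OF kij] by (auto simp: B_def)
      then show ?thesis by (intro exI[of _ "i * 2 ^ k + s"]) auto
    qed
    note ex_door = this
    define door where "door k i j = (SOME d. i * 2 ^ k \<le> d \<and> d < Suc i * 2 ^ k \<and> \<omega> (e k d j))" for k i j
    have door: "i * 2 ^ k \<le> door k i j \<and> door k i j < Suc i * 2 ^ k \<and> \<omega> (e k (door k i j) j)"
      if "K \<le> k" "i < 2 ^ k" "j < 4 ^ k" for k i j
      unfolding door_def by (rule someI_ex) (rule ex_door[OF that])
    have in_room: "in_room x y z" if "x < 4 ^ k" "y < 4 ^ k" "4 ^ k \<le> z" "z < 4 ^ Suc k" for k x y z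
    proof -
      have "z > 0" using that(3) by (metis gr0I not_le zero_less_numeral zero_less_power)
      then show ?thesis
        using that room_eqI[OF that(3,4)] by (simp add: in_room_def)
    qed
    have edgeU: "f \<in> edges ?U" if "f \<in> edges chain" for f
      using that by (rule subsetD[OF enlargement_supergraph(2)])
    have "rooms_with_doors ?U pt K door"
    proof
      have "subgraph ?U G" by (rule subgraph_enlargement[OF G(1,3)])
      then show "finite (neighbours ?U v)" for v
        using locally_finite_subgraph[OF _ G(2)] by (intro finite_neighbours) (auto simp: subgraph_def)
      show "pt x y z = pt x' y' z' \<Longrightarrow> x = x' \<and> y = y' \<and> z = z'" for x y z x' y' z'
        by (rule pt_inj)
      show "{pt x y z, pt (Suc x) y z} \<in> edges ?U"
        if "Suc x < 4 ^ k" "y < 4 ^ k" "z \<in> {4 ^ k..<4 ^ Suc k}" for k x y z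
        using that by (intro edgeU edges_chainI in_room[of _ k]) auto
      show "{pt x y z, pt x (Suc y) z} \<in> edges ?U"
        if "x < 4 ^ k" "Suc y < 4 ^ k" "z \<in> {4 ^ k..<4 ^ Suc k}" for k x y z
        using that by (intro edgeU edges_chainI in_room[of _ k]) auto
      show "{pt x y z, pt x y (Suc z)} \<in> edges ?U"
        if "x < 4 ^ k" "y < 4 ^ k" "4 ^ k \<le> z" "Suc z < 4 ^ Suc k" for k x y z
      proof -
        have "room z = k" "room (Suc z) = k" using that by (auto intro!: room_eqI simp del: power_Suc)
        then show ?thesis
          using that by (intro edgeU edges_chainI in_room[of _ k]) auto
      qed
      show "i * 2 ^ k \<le> door k i j \<and> door k i j < Suc i * 2 ^ k"
        if "K \<le> k" "i < 2 ^ k" "j < 4 ^ k" for k i j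
        using door that by blast
      show "{pt (door k i j) j (4 ^ Suc k - 1), pt (door k i j) j (4 ^ Suc k)} \<in> edges ?U"
        if kij: "K \<le> k" "i < 2 ^ k" "j < 4 ^ k" for k i j
      proof (rule open_edge_in_enlargement)
        have "door k i j < 4 ^ k" using block_less[OF kij(2)] door kij by blast
        moreover have "(1::nat) \<le> 4 ^ k" by simp
        then have "(4::nat) ^ k \<le> 4 ^ Suc k - 1" "(4::nat) ^ Suc k - 1 < 4 ^ Suc k"
          unfolding power_Suc by linarith+
        ultimately have "in_room (door k i j) j (4 ^ Suc k - 1)"
          using kij(3) by (intro in_room)
        then show "pt (door k i j) j (4 ^ Suc k - 1) \<in> verts chain"
          unfolding chain_def by auto
      qed (use e_edge[of k "door k i j" j] door[OF kij] in \<open>simp_all only: e_def\<close>)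
    qed
    then show "transient ?U"
    proof (rule transient_rooms_with_doors)
      show "connected_graph ?U" by (rule connected_enlargement[OF connected_chain])
      show "pt x y z \<in> verts ?U" if "x < 4 ^ K" "y < 4 ^ K" "z \<in> {4 ^ K..<4 ^ Suc K}" for x y z
      proof -
        have "in_room x y z" using that by (intro in_room[of _ K]) auto
        then have "pt x y z \<in> verts chain" by (auto simp: chain_def)
        then show ?thesis by (rule subsetD[OF enlargement_supergraph(1)])
      qed
    qed
  qed
qed

section \<open>The integer lattice\<close>

theorem theorem1p4:
  fixes \<epsilon> :: real
  assumes "CARD('d::finite) \<ge> 3" and "\<epsilon> > 0"
  shows "\<exists>H. subgraph H (int_lattice :: (int ^ 'd) ugraph) \<and> recurrent H \<and>
    pc2 (int_lattice :: (int ^ 'd) ugraph) H transient \<le> ereal \<epsilon>"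
proof -
  obtain T :: "'d set" where "card T = 3"
    using obtain_subset_with_card_n[OF assms(1)] by auto
  then obtain a b c :: 'd where abc: "a \<noteq> b" "b \<noteq> c" "a \<noteq> c"
    by (auto simp: card_3_iff)
  define pt :: "nat \<Rightarrow> nat \<Rightarrow> nat \<Rightarrow> int ^ 'd" where
    "pt = (\<lambda>x y z. \<chi> i. if i = a then int x else if i = b then int y else if i = c then int z else 0)"
  interpret grid pt
  proof
    fix x y z x' y' z' assume eq: "pt x y z = pt x' y' z'"
    have "pt x y z $ i = pt x' y' z' $ i" for i by (simp add: eq)
    from this[of a] this[of b] this[of c] show "x = x' \<and> y = y' \<and> z = z'"
      using abc by (auto simp: pt_def)
  qed
  have step: "{u, v} \<in> edges int_lattice" if "\<And>i. \<bar>u $ i - v $ i\<bar> = (if i = d then 1 else 0)"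
    for u v :: "int ^ 'd" and d
  proof -
    have "(\<Sum>i\<in>UNIV. \<bar>u $ i - v $ i\<bar>) = 1" by (simp add: that)
    then show ?thesis unfolding int_lattice_def ugraph.select_convs by blast
  qed
  have edges: "{pt x y z, pt (Suc x) y z} \<in> edges int_lattice"
      "{pt x y z, pt x (Suc y) z} \<in> edges int_lattice"
      "{pt x y z, pt x y (Suc z)} \<in> edges int_lattice" for x y z
    by (rule step[of _ _ a], use abc in \<open>simp add: pt_def\<close>)
       (rule step[of _ _ b], use abc in \<open>simp add: pt_def\<close>,
        rule step[of _ _ c], use abc in \<open>simp add: pt_def\<close>)
  have sub: "subgraph chain int_lattice"
    unfolding subgraph_def
    using simple_graph_chain edges by (auto simp: chain_def int_lattice_def[THEN arg_cong[where f = verts]])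
  \<comment> \<open>The enlargement is transient for every positive \<open>p\<close>; the minimum only keeps \<open>p\<close> a probability.\<close>
  define p where "p = min \<epsilon> 1"
  have p: "0 < p" "p \<le> 1" "p \<le> \<epsilon>" using assms(2) by (auto simp: p_def)
  have "AE \<omega> in percolation int_lattice p. transient (enlargement int_lattice chain \<omega>)"
    by (rule AE_transient_enlargement_chain[OF simple_graph_int_lattice locally_finite_int_lattice sub edges(3) p(1,2)])
  then have "pc2 int_lattice chain transient \<le> ereal p"
    unfolding pc2_def using p by (intro Inf_lower imageI) auto
  also have "\<dots> \<le> ereal \<epsilon>" using p by simp
  finally show ?thesis
    using sub recurrent_chain by blast
qed

end
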